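(* Let $(\gamma_l)_{l\ge1}$ be a real sequence with $\gamma_l>-1$ and $\lim_{l\to\infty}\frac{\gamma_l}{l}=c\ge0$. For $y\in\mathbb{R}$ let $$N_l^{(\gamma_l)}(y)=\#\{x\le y\mid H_l^{(\gamma_l)}(x)=0\}$$ be the number of zeros less than or equal to $y$ of the generalized Hermite polynomial $H_l^{(\gamma_l)}(x)$. Then for every $y\in\mathbb{R}$ $$\lim_{l\to\infty}\frac1l N_l^{(\gamma_l)}(\sqrt{l}\,y)=\frac1\pi\int_{-\infty}^{y}\frac{\sqrt{(c+1)-\left|x^2-\frac c2-1\right|^2}}{|x|}\,I\{x\in\overline{E_1}\}\,dx,$$ where $\overline{E_1}$ is the closure of the set $\{x\in\mathbb{R} : |x^2-\frac c2-1|<\sqrt{c+1}\}$.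
   Context: For $\gamma>-1$, $H_n^{(\gamma)}(x)$ denotes the generalized Hermite polynomial of degree $n$, i.e. the degree-$n$ orthogonal polynomial with respect to the measure $|x|^\gamma\exp(-x^2)dx$ on $\mathbb{R}$ (the normalization is irrelevant here). $I$ denotes the indicator function. *)

theory Defs
  imports "HOL-Analysis.Analysis" "HOL-Computational_Algebra.Polynomial"
begin

definition gen_hermite_measure :: "real \<Rightarrow> real measure" where
  "gen_hermite_measure \<gamma> = density lborel (\<lambda>x. ennreal (\<bar>x\<bar> powr \<gamma> * exp (- (x\<^sup>2))))"

(* All polynomials are integrable against the measures used here (\<gamma> > -1), so the value 0 that the
   Bochner integral assigns to non-integrable functions plays no role. The condition p \<noteq> 0 matters
   only for n = 0, because the zero polynomial has degree 0. *)
definition orthogonal_poly :: "real measure \<Rightarrow> nat \<Rightarrow> real poly \<Rightarrow> bool" where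
  "orthogonal_poly \<mu> n p \<longleftrightarrow>
     p \<noteq> 0 \<and> degree p = n \<and>
     (\<forall>q. degree q < n \<longrightarrow> (\<integral>x. poly p x * poly q x \<partial>\<mu>) = 0)"

(* The polynomial is determined by \<gamma> and n up to a nonzero constant factor; no normalization is
   fixed, hence a predicate rather than a function. *)
definition gen_hermite :: "real \<Rightarrow> nat \<Rightarrow> real poly \<Rightarrow> bool" where
  "gen_hermite \<gamma> n p \<longleftrightarrow> orthogonal_poly (gen_hermite_measure \<gamma>) n p"

definition zero_count :: "real poly \<Rightarrow> real \<Rightarrow> nat" where
  "zero_count p y = card {x. x \<le> y \<and> poly p x = 0}"

definition E1 :: "real \<Rightarrow> real set" where
  "E1 c = {x. \<bar>x\<^sup>2 - c / 2 - 1\<bar> < sqrt (c + 1)}"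

end

theory Submission
  imports Defs
begin

text \<open>For \<open>x \<noteq> 0\<close> the function \<open>\<bar>x\<bar> powr (g / 2) * exp (- x\<^sup>2 / 2) * H x\<close>, with \<open>H\<close> the generalized
  Hermite polynomial of degree \<open>n\<close>, solves \<open>u'' + q u = 0\<close> with
  \<open>q x = 2 * n + g + 1 - x\<^sup>2 - \<kappa> / x\<^sup>2\<close>, where \<open>\<kappa> = g\<^sup>2 / 4 - g / 2\<close> for even \<open>n\<close> and
  \<open>\<kappa> = g\<^sup>2 / 4 + g / 2\<close> for odd \<open>n\<close>. After the scaling \<open>x = sqrt l * s\<close>, the potential \<open>q / l\<close>
  converges to \<open>2 + c - s\<^sup>2 - c\<^sup>2 / (4 * s\<^sup>2)\<close>, the square of the claimed density (up to the factor
  \<open>pi\<close>). Sturm comparison with constant coefficients counts the zeros in short intervals up to a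
  bounded error, and a bisection argument adds up these local estimates. A cruder comparison controls
  the zeros near the singularity at 0.\<close>

section \<open>The moments of the weight\<close>

text \<open>Orthogonality is all that is known about \<open>H\<close>, so the equation has to be
  extracted from it: it is the eigenvalue equation of an operator on polynomials that is symmetric
  for the weight. Symmetry is checked on moments, where the functional equation of
  \<open>Gamma\<close> takes the place of integration by parts against a weight that is unbounded at
  0 for negative \<open>g\<close>. Two obstacles shape the asymptotic part. The term
  \<open>\<kappa> / x\<^sup>2\<close> is singular and of either sign, so the scaled potential
  converges locally uniformly only away from 0. Moreover each comparison may miss or gain about one
  zero per interval, so the number of intervals must stay fixed while \<open>l\<close> grows. Every
  estimate is therefore stated for a fixed interval and eventually in \<open>l\<close>, with an
  error \<open>l\<close> times the increment of a function \<open>E\<close>; such errors add up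
  along a subdivision.\<close>

lemma has_bochner_integral_powr_gaussian:
  fixes s :: real
  assumes s: "s > -1"
  shows "has_bochner_integral lborel (\<lambda>x. indicator {0..} x *\<^sub>R (x powr s * exp (- x\<^sup>2)))
           (Gamma ((s + 1) / 2) / 2)"
proof -
  define z where "z = (s + 1) / 2"
  have z: "z > 0" using s by (simp add: z_def)
  \<comment> \<open>Euler's integral for \<open>Gamma z\<close>, to be transformed by t = x^2. The
    Jacobian 2 x produces the exponent 2 (z - 1) + 1 = s.\<close>
  let ?f = "\<lambda>t::real. t powr (z - 1) / exp t"
  have f: "(?f has_integral Gamma z) {0..}" by (rule Gamma_integral_real[OF z])
  have img: "(\<lambda>x::real. x\<^sup>2) ` {0..} = {0..}"
  proof (intro equalityI subsetI)
    fix t :: real assume "t \<in> {0..}"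
    then show "t \<in> (\<lambda>x. x\<^sup>2) ` {0..}" by (intro image_eqI[of _ _ "sqrt t"]) auto
  qed auto
  have "(\<lambda>x. \<bar>2 * x\<bar> * ?f (x\<^sup>2)) absolutely_integrable_on {0..} \<and>
          integral {0..} (\<lambda>x. \<bar>2 * x\<bar> * ?f (x\<^sup>2)) = Gamma z
        \<longleftrightarrow> ?f absolutely_integrable_on ((\<lambda>x. x\<^sup>2) ` {0..}) \<and>
          integral ((\<lambda>x. x\<^sup>2) ` {0..}) ?f = Gamma z"
  proof (rule has_absolute_integral_change_of_variables_1')
    show "((\<lambda>x. x\<^sup>2) has_field_derivative 2 * x) (at x within {0..})" for x :: real
      by (auto intro!: derivative_eq_intros)
    show "inj_on (\<lambda>x::real. x\<^sup>2) {0..}"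
      by (auto simp: inj_on_def power2_eq_iff_nonneg)
  qed simp
  moreover have "?f absolutely_integrable_on {0..}"
    by (rule nonnegative_absolutely_integrable_1) (use f in auto)
  ultimately have "((\<lambda>x. \<bar>2 * x\<bar> * ?f (x\<^sup>2)) has_integral Gamma z) {0..}"
    unfolding img using f set_lebesgue_integral_eq_integral(1)
    by (blast intro: has_integral_iff[THEN iffD2] dest: has_integral_iff[THEN iffD1])
  then have "((\<lambda>x. 1/2 * (\<bar>2 * x\<bar> * ?f (x\<^sup>2))) has_integral 1/2 * Gamma z) {0..}"
    by (rule has_integral_mult_right)
  also have "?this \<longleftrightarrow> ((\<lambda>x. x powr s * exp (- x\<^sup>2)) has_integral 1/2 * Gamma z) {0..}"
  proof (rule has_integral_cong)
    fix x :: real assume x: "x \<in> {0..}"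
    show "1/2 * (\<bar>2 * x\<bar> * ?f (x\<^sup>2)) = x powr s * exp (- x\<^sup>2)"
    proof (cases "x = 0")
      case False
      then have "x\<^sup>2 = x powr 2" "x > 0" using x by (simp_all add: powr_numeral)
      then have "x * (x\<^sup>2) powr (z - 1) = x powr 1 * x powr (2 * (z - 1))"
        by (simp only: powr_powr) simp
      also have "\<dots> = x powr s"
        by (subst powr_add[symmetric]) (simp add: z_def field_simps)
      finally show ?thesis using \<open>x > 0\<close> by (simp add: exp_minus field_simps)
    qed simp
  qed
  finally have "((\<lambda>x. x powr s * exp (- x\<^sup>2)) has_integral 1/2 * Gamma z) {0..}" .
  then have "(\<integral>\<^sup>+ x. ennreal (indicator {0..} x * (x powr s * exp (- x\<^sup>2))) \<partial>lborel)
      = ennreal (1/2 * Gamma z)"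
    by (intro nn_integral_has_integral_lebesgue) auto
  then show ?thesis
    using z by (intro has_bochner_integral_nn_integral)
      (auto simp: z_def Gamma_real_pos[THEN less_imp_le])
qed

lemma has_bochner_integral_gen_hermite_density:
  fixes g :: real
  assumes g: "g > -1"
  shows "has_bochner_integral lborel (\<lambda>x. x ^ k * (\<bar>x\<bar> powr g * exp (- x\<^sup>2)))
           (if even k then Gamma ((real k + g + 1) / 2) else 0)"
proof -
  let ?f = "\<lambda>x::real. x ^ k * (\<bar>x\<bar> powr g * exp (- x\<^sup>2))"
  have "has_bochner_integral lborel
      (\<lambda>x. indicator {0..} x *\<^sub>R (x powr (real k + g) * exp (- x\<^sup>2)))
      (Gamma ((real k + g + 1) / 2) / 2)"
    using g by (intro has_bochner_integral_powr_gaussian) auto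
  also have "?this \<longleftrightarrow> has_bochner_integral lborel (\<lambda>x. indicator {0..} x *\<^sub>R ?f x)
      (Gamma ((real k + g + 1) / 2) / 2)"
  proof (rule has_bochner_integral_cong_AE)
    show "AE x in lborel. indicator {0..} x *\<^sub>R (x powr (real k + g) * exp (- x\<^sup>2)) =
        indicator {0..} x *\<^sub>R ?f x"
      using AE_lborel_singleton[of 0]
      by eventually_elim (auto simp: indicator_def powr_add powr_realpow)
  qed measurable
  finally have *: "has_bochner_integral lborel (\<lambda>x. indicator {0..} x *\<^sub>R ?f x)
      (Gamma ((real k + g + 1) / 2) / 2)" .
  show ?thesis
  proof (cases "even k")
    case True
    then show ?thesis using has_bochner_integral_even_function[OF *] by simp
  next
    case False
    then show ?thesis using has_bochner_integral_odd_function[OF *] by simp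
  qed
qed

definition gen_hermite_moment :: "real \<Rightarrow> nat \<Rightarrow> real" where
  "gen_hermite_moment g k = (if even k then Gamma ((real k + g + 1) / 2) else 0)"

lemma gen_hermite_moment_odd: "odd k \<Longrightarrow> gen_hermite_moment g k = 0"
  by (simp add: gen_hermite_moment_def)

text \<open>Functional equation of \<open>Gamma\<close>. This recursion stands in for integration by
  parts against the weight.\<close>

lemma gen_hermite_moment_rec:
  assumes "g > -1"
  shows "2 * gen_hermite_moment g (k + 2) = (real k + g + 1) * gen_hermite_moment g k"
proof (cases "even k")
  case True
  have nn: "(real k + g + 1) / 2 \<notin> \<int>\<^sub>\<le>\<^sub>0"
  proof
    assume "(real k + g + 1) / 2 \<in> \<int>\<^sub>\<le>\<^sub>0"
    then have "(real k + g + 1) / 2 \<le> 0" by (rule nonpos_Ints_nonpos)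
    then show False using assms by simp
  qed
  have eq: "(real (k + 2) + g + 1) / 2 = (real k + g + 1) / 2 + 1" by simp
  have "Gamma ((real (k + 2) + g + 1) / 2) = (real k + g + 1) / 2 * Gamma ((real k + g + 1) / 2)"
    unfolding eq by (rule Gamma_plus1) (use nn in auto)
  then show ?thesis using True by (simp add: gen_hermite_moment_def)
qed (simp add: gen_hermite_moment_def)

lemma has_bochner_integral_gen_hermite_measure_power:
  assumes "g > -1"
  shows "has_bochner_integral (gen_hermite_measure g) (\<lambda>x. x ^ k) (gen_hermite_moment g k)"
  using has_bochner_integral_gen_hermite_density[OF assms, of k]
  unfolding has_bochner_integral_iff gen_hermite_measure_def gen_hermite_moment_def
  by (auto simp: integrable_density integral_density mult.commute)

section \<open>Polynomials in the inner product given by the weight\<close>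

lemma poly_altdef_le:
  fixes p :: "real poly"
  assumes "degree p \<le> n"
  shows "poly p x = (\<Sum>i\<le>n. coeff p i * x ^ i)"
proof -
  have "(\<Sum>i\<le>n. coeff p i * x ^ i) = (\<Sum>i\<le>degree p. coeff p i * x ^ i)"
    using assms by (intro sum.mono_neutral_right) (auto simp: coeff_eq_0)
  then show ?thesis by (simp add: poly_altdef)
qed

lemma has_bochner_integral_gen_hermite_measure_mult:
  assumes g: "g > -1" and "degree p \<le> n" "degree q \<le> m"
  shows "has_bochner_integral (gen_hermite_measure g) (\<lambda>x. poly p x * poly q x)
    (\<Sum>j\<le>m. coeff q j * (\<Sum>i\<le>n. coeff p i * gen_hermite_moment g (i + j)))"
proof -
  have "has_bochner_integral (gen_hermite_measure g)
     (\<lambda>x. \<Sum>j\<le>m. coeff q j * (\<Sum>i\<le>n. coeff p i * x ^ (i + j)))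
     (\<Sum>j\<le>m. coeff q j * (\<Sum>i\<le>n. coeff p i * gen_hermite_moment g (i + j)))"
    by (intro has_bochner_integral_sum has_bochner_integral_mult_right
          has_bochner_integral_gen_hermite_measure_power g)
  also have "(\<lambda>x. \<Sum>j\<le>m. coeff q j * (\<Sum>i\<le>n. coeff p i * x ^ (i + j))) =
      (\<lambda>x. poly p x * poly q x)"
    by (simp add: fun_eq_iff poly_altdef_le[OF assms(2)] poly_altdef_le[OF assms(3)]
          sum_product sum_distrib_left power_add mult_ac sum.swap[of _ "{..m}"])
  finally show ?thesis .
qed

text \<open>The weight is positive off 0, so \<open>r\<close> vanishes almost everywhere, which a
  nonzero polynomial with its finitely many roots cannot do. This definiteness turns orthogonality
  into an identity of polynomials in \<open>gen_hermite_eigen\<close>.\<close>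

lemma gen_hermite_measure_square_eq_0:
  assumes g: "g > -1" and 0: "(\<integral>x. poly r x * poly r x \<partial>gen_hermite_measure g) = 0"
  shows "r = 0"
proof (rule ccontr)
  assume "r \<noteq> 0"
  let ?w = "\<lambda>x::real. \<bar>x\<bar> powr g * exp (- x\<^sup>2)"
  have int: "integrable (gen_hermite_measure g) (\<lambda>x. poly r x * poly r x)"
    using has_bochner_integral_gen_hermite_measure_mult[OF g order_refl order_refl]
    by (auto simp: has_bochner_integral_iff)
  have "AE x in gen_hermite_measure g. poly r x * poly r x = 0"
    using integral_nonneg_eq_0_iff_AE[OF int] 0 by simp
  then have "AE x in lborel. ennreal (?w x) > 0 \<longrightarrow> poly r x * poly r x = 0"
    unfolding gen_hermite_measure_def by (subst (asm) AE_density) auto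
  moreover have "AE x::real in lborel. x \<noteq> 0" by (rule AE_lborel_singleton)
  ultimately have "AE x in lborel. poly r x = 0"
    by eventually_elim (simp add: ennreal_less_zero_iff)
  moreover have "AE x::real in lborel. x \<notin> {x. poly r x = 0}"
    using poly_roots_finite[OF \<open>r \<noteq> 0\<close>]
    by (intro AE_not_in finite_imp_null_set_lborel)
  ultimately have "AE x::real in lborel. False" by eventually_elim simp
  then show False by (simp add: AE_iff_measurable[OF _ refl])
qed

section \<open>The differential equation\<close>

text \<open>The factor with which x^k is sent to x^(k-2) by the squared Dunkl operator f'' + (g/x)
  f' - g (f(x) - f(-x)) / (2 x^2). The reflection term makes it vanish at k = 1 as well as at k = 0,
  so no negative powers arise.\<close>

definition hermite_coeff :: "real \<Rightarrow> nat \<Rightarrow> real" where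
  "hermite_coeff g k = real k * (real k - 1) + g * (real k - (if odd k then 1 else 0))"

text \<open>The squared Dunkl operator minus 2 x d/dx, given by coefficients so that no division by
  x occurs.\<close>

definition hermite_op :: "real \<Rightarrow> real poly \<Rightarrow> real poly" where
  "hermite_op g p = Poly (map (\<lambda>k. hermite_coeff g (k + 2) * coeff p (k + 2) -
     2 * real k * coeff p k) [0..<Suc (degree p)])"

lemma coeff_hermite_op:
  "coeff (hermite_op g p) k = hermite_coeff g (k + 2) * coeff p (k + 2) - 2 * real k * coeff p k"
  by (cases "k \<le> degree p")
    (auto simp: hermite_op_def nth_default_def coeff_eq_0 simp del: upt_Suc)

lemma degree_hermite_op_le: "degree (hermite_op g p) \<le> degree p"
  by (rule degree_le) (simp add: coeff_hermite_op coeff_eq_0)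

text \<open>The Dirichlet form, i.e. the integral of f' h' + g f_odd h_odd / x^2, at f = x^i and h =
  x^j, where f_odd is the odd part of f. It is symmetric because i and j have the same parity
  whenever i + j is even.\<close>

definition hermite_form :: "real \<Rightarrow> nat \<Rightarrow> nat \<Rightarrow> real" where
  "hermite_form g i j = (if i = 0 \<or> j = 0 \<or> odd (i + j) then 0
     else (real i * real j + (if odd i then g else 0)) * gen_hermite_moment g (i + j - 2))"

lemma hermite_form_commute: "hermite_form g i j = hermite_form g j i"
  by (auto simp: hermite_form_def add.commute)

text \<open>The image of x^i is paired with x^j. The moment recursion lowers i + j to i + j - 2, and
  i (i - 1) + g i - i (i + j + g - 1) collapses to - i j. For i < 2 the truncated
  \<open>i - 2\<close> is harmless because \<open>hermite_coeff g i\<close> is 0.\<close>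

lemma hermite_form_eq:
  assumes g: "g > -1"
  shows "hermite_coeff g i * gen_hermite_moment g (i - 2 + j) - 2 * real i * gen_hermite_moment g (i + j)
    = - hermite_form g i j"
proof -
  consider "odd (i + j)" | "even (i + j)" "i = 0" | "even (i + j)" "i = 1"
    | k where "even (i + j)" "i = k + 2"
    by (metis One_nat_def add_2_eq_Suc' not0_implies_Suc)
  then show ?thesis
  proof cases
    case 1
    then have "i = 0 \<or> i = 1 \<or> odd (i - 2 + j)" by auto
    then show ?thesis using 1
      by (auto simp: hermite_form_def gen_hermite_moment_odd hermite_coeff_def)
  next
    case 2
    then show ?thesis by (simp add: hermite_form_def hermite_coeff_def)
  next
    case 3
    then obtain j' where j: "j = Suc j'" by (cases j) auto
    show ?thesis using 3 gen_hermite_moment_rec[OF g, of j']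
      by (simp add: j hermite_form_def hermite_coeff_def algebra_simps)
  next
    case (4 k)
    have "2 * gen_hermite_moment g (i + j) = (real (k + j) + g + 1) * gen_hermite_moment g (k + j)"
      using gen_hermite_moment_rec[OF g, of "k + j"] 4 by (simp add: add_ac)
    then have *: "hermite_coeff g i * gen_hermite_moment g (i - 2 + j) -
         2 * real i * gen_hermite_moment g (i + j) =
         (hermite_coeff g i - real i * (real (k + j) + g + 1)) * gen_hermite_moment g (k + j)"
      using 4 by (simp add: algebra_simps)
    also have "hermite_coeff g i - real i * (real (k + j) + g + 1) =
        - (real i * real j + (if odd i then g else 0))"
      using 4 by (simp add: hermite_coeff_def algebra_simps)
    finally have "hermite_coeff g i * gen_hermite_moment g (i - 2 + j) -
        2 * real i * gen_hermite_moment g (i + j) =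
        - ((real i * real j + (if odd i then g else 0)) * gen_hermite_moment g (k + j))"
      by (simp only: minus_mult_left)
    moreover have "real i * real j + (if odd i then g else 0) = 0" if "j = 0"
      using 4 that by auto
    ultimately show ?thesis using 4 by (cases "j = 0") (simp_all add: hermite_form_def)
  qed
qed

lemma hermite_op_moment:
  assumes g: "g > -1" and p: "degree p \<le> n"
  shows "(\<Sum>i\<le>n. coeff (hermite_op g p) i * gen_hermite_moment g (i + j)) =
    - (\<Sum>i\<le>n. coeff p i * hermite_form g i j)"
proof -
  let ?m = "gen_hermite_moment g"
  let ?F = "\<lambda>i. hermite_coeff g i * coeff p i * ?m (i - 2 + j)"
  \<comment> \<open>Re-indexing from target to source exponent: the indices 0 and 1 may be added
    since \<open>hermite_coeff\<close> vanishes there, and those above \<open>n\<close> drop out by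
    the degree bound.\<close>
  have "(\<Sum>i\<le>n. ?F (i + 2)) = (\<Sum>i\<in>{2..n+2}. ?F i)"
    by (rule sum.reindex_bij_witness[of _ "\<lambda>i. i - 2" "\<lambda>i. i + 2"]) auto
  also have "\<dots> = (\<Sum>i\<le>n+2. ?F i)"
  proof (rule sum.mono_neutral_left)
    show "\<forall>i\<in>{..n + 2} - {2..n + 2}. ?F i = 0"
    proof
      fix i assume "i \<in> {..n + 2} - {2..n + 2}"
      then have "i = 0 \<or> i = 1" by auto
      then show "?F i = 0" by (auto simp: hermite_coeff_def)
    qed
  qed auto
  also have "\<dots> = (\<Sum>i\<le>n. ?F i)"
    using p by (intro sum.mono_neutral_right) (auto simp: coeff_eq_0)
  finally have shift: "(\<Sum>i\<le>n. ?F (i + 2)) = (\<Sum>i\<le>n. ?F i)" .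
  have "(\<Sum>i\<le>n. coeff (hermite_op g p) i * ?m (i + j)) =
      (\<Sum>i\<le>n. ?F (i + 2)) - (\<Sum>i\<le>n. 2 * real i * coeff p i * ?m (i + j))"
    by (simp add: coeff_hermite_op sum_subtractf left_diff_distrib)
  also have "\<dots> = (\<Sum>i\<le>n. coeff p i *
      (hermite_coeff g i * ?m (i - 2 + j) - 2 * real i * ?m (i + j)))"
    unfolding shift by (simp add: sum_subtractf right_diff_distrib mult_ac)
  also have "\<dots> = - (\<Sum>i\<le>n. coeff p i * hermite_form g i j)"
    unfolding hermite_form_eq[OF g] by (simp add: sum_negf)
  finally show ?thesis .
qed

text \<open>Both sides are minus the same symmetric bilinear form; a common degree bound
  \<open>n\<close> lets the double sum be swapped.\<close>

lemma hermite_op_symmetric: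
  assumes g: "g > -1"
  shows "(\<integral>x. poly (hermite_op g p) x * poly q x \<partial>gen_hermite_measure g) =
    (\<integral>x. poly p x * poly (hermite_op g q) x \<partial>gen_hermite_measure g)"
proof -
  define n where "n = max (degree p) (degree q)"
  have le: "degree p \<le> n" "degree q \<le> n" by (auto simp: n_def)
  have le': "degree (hermite_op g p) \<le> n" "degree (hermite_op g q) \<le> n"
    using le degree_hermite_op_le order_trans by blast+
  have form: "(\<integral>x. poly (hermite_op g p) x * poly q x \<partial>gen_hermite_measure g) =
      - (\<Sum>j\<le>n. \<Sum>i\<le>n. coeff p i * coeff q j * hermite_form g i j)"
    if "degree p \<le> n" "degree q \<le> n" "degree (hermite_op g p) \<le> n" for p q
    unfolding has_bochner_integral_integral_eq[OF
        has_bochner_integral_gen_hermite_measure_mult[OF g that(3) that(2)]]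
      hermite_op_moment[OF g that(1)]
    by (simp add: sum_negf sum_distrib_left mult.left_commute mult.assoc)
  have "(\<integral>x. poly p x * poly (hermite_op g q) x \<partial>gen_hermite_measure g) =
      (\<integral>x. poly (hermite_op g q) x * poly p x \<partial>gen_hermite_measure g)"
    by (simp add: mult.commute)
  also have "\<dots> = - (\<Sum>j\<le>n. \<Sum>i\<le>n. coeff q i * coeff p j * hermite_form g i j)"
    by (rule form) (use le le' in auto)
  also have "\<dots> = - (\<Sum>j\<le>n. \<Sum>i\<le>n. coeff p i * coeff q j * hermite_form g i j)"
    by (subst sum.swap) (simp add: hermite_form_commute mult.commute)
  also have "\<dots> = (\<integral>x. poly (hermite_op g p) x * poly q x \<partial>gen_hermite_measure g)"
    by (rule form[symmetric]) (use le le' in auto)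
  finally show ?thesis ..
qed

text \<open>The operator does not raise degrees and multiplies the leading coefficient by -2n, so
  \<open>r\<close> has degree below \<open>n\<close>. Symmetry moves the operator from
  \<open>p\<close> onto \<open>r\<close>, whose image again has degree below \<open>n\<close>; hence
  \<open>r\<close> is orthogonal to itself.\<close>

lemma gen_hermite_eigen:
  assumes g: "g > -1" and n: "n \<ge> 1" and p: "gen_hermite g n p"
  shows "hermite_op g p = smult (- 2 * real n) p"
proof -
  let ?\<mu> = "gen_hermite_measure g"
  have deg: "degree p = n" and orth: "\<And>q. degree q < n \<Longrightarrow> (\<integral>x. poly p x * poly q x \<partial>?\<mu>) = 0"
    using p by (auto simp: gen_hermite_def orthogonal_poly_def)
  define r where "r = hermite_op g p + smult (2 * real n) p"
  have r: "degree r < n"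
  proof (rule degree_lessI)
    show "\<forall>k\<ge>n. coeff r k = 0"
    proof (intro allI impI)
      fix k assume "k \<ge> n"
      then show "coeff r k = 0"
        by (cases "k = n") (auto simp: r_def coeff_hermite_op coeff_eq_0 deg)
    qed
  qed (use n in auto)
  have int: "integrable ?\<mu> (\<lambda>x. poly a x * poly b x)" for a b
    using has_bochner_integral_gen_hermite_measure_mult[OF g order_refl order_refl]
    by (auto simp: has_bochner_integral_iff)
  have "(\<integral>x. poly r x * poly r x \<partial>?\<mu>) =
      (\<integral>x. poly (hermite_op g p) x * poly r x + 2 * real n * (poly p x * poly r x) \<partial>?\<mu>)"
    by (simp add: r_def algebra_simps)
  also have "\<dots> = (\<integral>x. poly (hermite_op g p) x * poly r x \<partial>?\<mu>) +
      2 * real n * (\<integral>x. poly p x * poly r x \<partial>?\<mu>)"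
    by (simp add: int)
  also have "\<dots> = 0"
    using orth[OF r] orth[of "hermite_op g r"] r degree_hermite_op_le[of g r]
    by (simp add: hermite_op_symmetric[OF g])
  finally have "r = 0" by (rule gen_hermite_measure_square_eq_0[OF g])
  then show ?thesis by (simp add: r_def add_eq_0_iff2)
qed

lemma gen_hermite_coeff_rec:
  assumes "g > -1" "n \<ge> 1" "gen_hermite g n p"
  shows "hermite_coeff g (k + 2) * coeff p (k + 2) = 2 * (real k - real n) * coeff p k"
  using arg_cong[OF gen_hermite_eigen[OF assms], of "\<lambda>q. coeff q k"]
  by (simp add: coeff_hermite_op algebra_simps)

text \<open>Downward induction in steps of two. Coefficients above \<open>n\<close> vanish, and the
  factor k - n of the recursion is nonzero because k and n have opposite parity; \<open>j\<close>
  bounds the number of steps needed to get past \<open>n\<close>.\<close>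

lemma gen_hermite_parity:
  assumes "g > -1" "n \<ge> 1" "gen_hermite g n p" "odd (n + k)"
  shows "coeff p k = 0"
proof -
  have "coeff p k = 0" if "k + 2 * j > n" "odd (n + k)" for j k
    using that
  proof (induction j arbitrary: k)
    case 0
    then show ?case using assms(3) by (auto simp: gen_hermite_def orthogonal_poly_def coeff_eq_0)
  next
    case (Suc j)
    then have "coeff p (k + 2) = 0" by (intro Suc.IH) auto
    moreover have "k \<noteq> n" using Suc.prems by auto
    ultimately show ?case using gen_hermite_coeff_rec[OF assms(1-3), of k] by simp
  qed
  from this[of k "Suc n"] assms(4) show ?thesis by simp
qed

lemma gen_hermite_neg:
  assumes "g > -1" "n \<ge> 1" "gen_hermite g n p"
  shows "poly p (- x) = (- 1) ^ n * poly p x"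
proof -
  have *: "coeff p i * (- x) ^ i = (- 1) ^ n * (coeff p i * x ^ i)" for i
  proof (cases "odd (n + i)")
    case True
    then show ?thesis using gen_hermite_parity[OF assms] by simp
  next
    case False
    then have "(- x) ^ i = (- 1) ^ n * x ^ i" by (cases "even n") auto
    then show ?thesis by simp
  qed
  show ?thesis unfolding poly_altdef sum_distrib_left * ..
qed

text \<open>By parity, the reflection hidden in the operator acts on \<open>p\<close> as a sign, so
  the eigenvalue equation becomes a differential equation with the constant
  \<open>\<theta>\<close>.\<close>

lemma gen_hermite_ode:
  fixes x :: real
  assumes "g > -1" "n \<ge> 1" "gen_hermite g n p" and x: "x \<noteq> 0"
  shows "poly (pderiv (pderiv p)) x + (g / x - 2 * x) * poly (pderiv p) x +
    (2 * real n - (if odd n then g else 0) / x\<^sup>2) * poly p x = 0"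
proof -
  define \<theta> where "\<theta> = (if odd n then g else 0)"
  \<comment> \<open>The left-hand side times x^2, as a polynomial. Its coefficients 0 and 1, which
    the recursion does not reach, vanish by parity.\<close>
  define P where "P = pCons 0 (pCons 0 (pderiv (pderiv p))) + smult g (pCons 0 (pderiv p))
    - smult 2 (pCons 0 (pCons 0 (pCons 0 (pderiv p)))) + smult (2 * real n) (pCons 0 (pCons 0 p))
    - smult \<theta> p"
  have "P = 0"
  proof (rule poly_eqI)
    fix k :: nat
    consider "k = 0" | "k = 1" | j where "k = j + 2"
      by (metis One_nat_def add_2_eq_Suc' not0_implies_Suc)
    then show "coeff P k = coeff 0 k"
    proof cases
      case 1
      then show ?thesis using gen_hermite_parity[OF assms(1-3), of 0]
        by (auto simp: P_def \<theta>_def coeff_pCons)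
    next
      case 2
      then show ?thesis using gen_hermite_parity[OF assms(1-3), of 1]
        by (auto simp: P_def \<theta>_def coeff_pCons coeff_pderiv)
    next
      case (3 j)
      have "coeff P k = (real k * (real k - 1) + g * real k - \<theta>) * coeff p k -
          2 * (real j - real n) * coeff p j"
        using 3 by (cases j) (simp_all add: P_def coeff_pCons coeff_pderiv algebra_simps)
      also have "(real k * (real k - 1) + g * real k - \<theta>) * coeff p k = hermite_coeff g k * coeff p k"
        using gen_hermite_parity[OF assms(1-3), of k]
        by (cases "odd (n + k)") (auto simp: \<theta>_def hermite_coeff_def algebra_simps)
      finally show ?thesis using gen_hermite_coeff_rec[OF assms(1-3), of j] 3 by simp
    qed
  qed
  have eq: "x\<^sup>2 * (a + (g / x - 2 * x) * b + (2 * real n - \<theta> / x\<^sup>2) * c) =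
      x * (x * a) + g * (x * b) - 2 * (x * (x * (x * b))) + 2 * real n * (x * (x * c)) - \<theta> * c"
    for a b c :: real
    using x by (simp add: field_simps power2_eq_square)
  have "x\<^sup>2 * (poly (pderiv (pderiv p)) x + (g / x - 2 * x) * poly (pderiv p) x +
      (2 * real n - \<theta> / x\<^sup>2) * poly p x) = poly P x"
    unfolding eq by (simp add: P_def algebra_simps)
  also have "\<dots> = 0" by (simp add: \<open>P = 0\<close>)
  finally show ?thesis using x by (simp add: \<theta>_def)
qed

section \<open>Sturm comparison\<close>

text \<open>Picone's argument in Riccati form, with \<open>h\<close> the logarithmic derivative of a
  comparison function: the derivative of \<open>F\<close> is (u' - u h)^2 plus a positive multiple
  of u^2. \<open>F\<close> vanishes at both ends, hence in between, and so does
  \<open>u\<close>.\<close>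

lemma sturm_zeros_unique:
  fixes u u' q h h' :: "real \<Rightarrow> real"
  assumes u: "\<And>x. a \<le> x \<Longrightarrow> x \<le> b \<Longrightarrow> (u has_real_derivative u' x) (at x)"
    and u': "\<And>x. a \<le> x \<Longrightarrow> x \<le> b \<Longrightarrow> (u' has_real_derivative - q x * u x) (at x)"
    and h: "\<And>x. a \<le> x \<Longrightarrow> x \<le> b \<Longrightarrow> (h has_real_derivative h' x) (at x)"
    and less: "\<And>x. a \<le> x \<Longrightarrow> x \<le> b \<Longrightarrow> h' x < - q x - (h x)\<^sup>2"
    and zero: "u a = 0" "u b = 0" and x: "a < x" "x < b"
  shows "u x = 0"
proof -
  define F where "F = (\<lambda>x. u x * u' x - (u x)\<^sup>2 * h x)"
  define F' where "F' = (\<lambda>x. (u' x - u x * h x)\<^sup>2 + (- h' x - q x - (h x)\<^sup>2) * (u x)\<^sup>2)"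
  have F: "(F has_real_derivative F' x) (at x)" if "a \<le> x" "x \<le> b" for x
    unfolding F_def F'_def using that
    by (auto intro!: derivative_eq_intros u u' h simp: power2_eq_square algebra_simps)
  have F'_ge: "F' x \<ge> (- h' x - q x - (h x)\<^sup>2) * (u x)\<^sup>2" for x by (simp add: F'_def)
  have F'_nonneg: "F' x \<ge> 0" if "a \<le> x" "x \<le> b" for x
    using less[OF that] by (intro order_trans[OF _ F'_ge] mult_nonneg_nonneg) auto
  have F_mono: "F s \<le> F t" if "a \<le> s" "s \<le> t" "t \<le> b" for s t
  proof (rule DERIV_nonneg_imp_nondecreasing[OF that(2)])
    fix y assume "s \<le> y" "y \<le> t"
    then show "\<exists>d. (F has_real_derivative d) (at y) \<and> d \<ge> 0"
      using F[of y] F'_nonneg[of y] that by force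
  qed
  have F0: "F y = 0" if "a \<le> y" "y \<le> b" for y
    using F_mono[of a y] F_mono[of y b] that zero by (simp add: F_def)
  have "F' x = 0"
  proof (rule DERIV_local_const[OF F])
    show "0 < min (x - a) (b - x)" using x by simp
    show "\<forall>y. \<bar>x - y\<bar> < min (x - a) (b - x) \<longrightarrow> F x = F y"
      using x by (auto simp: F0 abs_real_def split: if_splits)
  qed (use x in auto)
  then have "(- h' x - q x - (h x)\<^sup>2) * (u x)\<^sup>2 \<le> 0" using F'_ge[of x] by simp
  moreover have "- h' x - q x - (h x)\<^sup>2 > 0" using less[of x] x by simp
  ultimately have "(u x)\<^sup>2 \<le> 0" by (simp add: mult_le_0_iff)
  then show ?thesis by simp
qed

text \<open>A Pruefer angle: without a zero of \<open>u\<close>, arctan (u' / (\<omega> u)) +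
  \<omega> x would be nonincreasing, but \<omega> x gains at least pi while an arctangent loses
  strictly less than pi.\<close>

lemma sturm_zero_exists:
  fixes u u' q :: "real \<Rightarrow> real"
  assumes u: "\<And>x. a \<le> x \<Longrightarrow> x \<le> b \<Longrightarrow> (u has_real_derivative u' x) (at x)"
    and u': "\<And>x. a \<le> x \<Longrightarrow> x \<le> b \<Longrightarrow> (u' has_real_derivative - q x * u x) (at x)"
    and q: "\<And>x. a \<le> x \<Longrightarrow> x \<le> b \<Longrightarrow> q x \<ge> \<omega>\<^sup>2"
    and \<omega>: "\<omega> > 0" "\<omega> * (b - a) \<ge> pi"
  shows "\<exists>x. a \<le> x \<and> x \<le> b \<and> u x = 0"
proof (rule ccontr)
  assume "\<not> ?thesis"
  then have nz: "u x \<noteq> 0" if "a \<le> x" "x \<le> b" for x using that by auto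
  have "\<omega> * (b - a) > 0" using \<omega> pi_gt_zero by linarith
  then have "a \<le> b" using \<omega>(1) by (simp add: zero_less_mult_iff)
  define f where "f = (\<lambda>x. arctan (u' x / u x / \<omega>) + \<omega> * x)"
  have "f b \<le> f a"
  proof (rule DERIV_nonpos_imp_nonincreasing[OF \<open>a \<le> b\<close>])
    fix x assume x: "a \<le> x" "x \<le> b"
    define h where "h = u' x / u x"
    have "((\<lambda>x. u' x / u x) has_real_derivative - q x - h\<^sup>2) (at x)"
      unfolding h_def using x nz[OF x]
      by (auto intro!: derivative_eq_intros u u' simp: field_simps power2_eq_square)
    from DERIV_cdivide[OF this, of \<omega>]
    have "((\<lambda>x. u' x / u x / \<omega>) has_real_derivative (- q x - h\<^sup>2) / \<omega>) (at x)" .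
    from DERIV_chain2[OF DERIV_arctan this]
    have "((\<lambda>x. arctan (u' x / u x / \<omega>)) has_real_derivative
        (- q x - h\<^sup>2) / \<omega> / (1 + (h / \<omega>)\<^sup>2)) (at x)"
      by (simp add: h_def divide_inverse mult.commute)
    moreover have "((\<lambda>x. \<omega> * x) has_real_derivative \<omega>) (at x)"
      by (auto intro!: derivative_eq_intros)
    ultimately have "(f has_real_derivative (- q x - h\<^sup>2) / \<omega> / (1 + (h / \<omega>)\<^sup>2) + \<omega>) (at x)"
      unfolding f_def h_def by (rule DERIV_add)
    moreover have "(- q x - h\<^sup>2) / \<omega> / (1 + (h / \<omega>)\<^sup>2) + \<omega> \<le> 0"
    proof -
      have "(- q x - h\<^sup>2) / \<omega> \<le> (- \<omega>\<^sup>2 - h\<^sup>2) / \<omega>"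
        using q[OF x] \<omega>(1) by (intro divide_right_mono) auto
      also have "\<dots> = - \<omega> * (1 + (h / \<omega>)\<^sup>2)"
        using \<omega>(1) by (simp add: field_simps power2_eq_square)
      finally have "(- q x - h\<^sup>2) / \<omega> / (1 + (h / \<omega>)\<^sup>2) \<le> - \<omega>"
        by (subst pos_divide_le_eq) (auto intro: add_pos_nonneg)
      then show ?thesis by simp
    qed
    ultimately show "\<exists>d. (f has_real_derivative d) (at x) \<and> d \<le> 0" by blast
  qed
  moreover have "- (pi / 2) < arctan (u' b / u b / \<omega>)" "arctan (u' a / u a / \<omega>) < pi / 2"
    by (rule arctan_lbound arctan_ubound)+
  ultimately show False using \<omega>(2) by (simp add: f_def right_diff_distrib)
qed

text \<open>The logarithmic derivative of cos (\<omega> (x - m)), taken where the cosine is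
  positive, solves the Riccati equation of the constant potential \<omega>^2.\<close>

lemma riccati_tan:
  assumes "\<bar>\<omega> * (x - m)\<bar> < pi / 2"
  shows "((\<lambda>x. - \<omega> * tan (\<omega> * (x - m))) has_real_derivative
    - \<omega>\<^sup>2 - (- \<omega> * tan (\<omega> * (x - m)))\<^sup>2) (at x)"
proof -
  have "cos (\<omega> * (x - m)) > 0" using assms by (intro cos_gt_zero_pi) auto
  then have c: "cos (\<omega> * (x - m)) \<noteq> 0" by simp
  have "((\<lambda>x. - \<omega> * tan (\<omega> * (x - m))) has_real_derivative
      - \<omega> * (inverse ((cos (\<omega> * (x - m)))\<^sup>2) * \<omega>)) (at x)"
    by (rule derivative_eq_intros refl c | simp)+
  also have "inverse ((cos (\<omega> * (x - m)))\<^sup>2) = 1 + (tan (\<omega> * (x - m)))\<^sup>2"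
    using tan_sec[OF c] by (simp add: power_inverse)
  finally show ?thesis by (simp add: power2_eq_square algebra_simps)
qed

section \<open>Spacing of the zeros\<close>

definition hermite_potential :: "real \<Rightarrow> nat \<Rightarrow> real \<Rightarrow> real" where
  "hermite_potential g n x =
     2 * real n + g + 1 - x\<^sup>2 - (g\<^sup>2 / 4 - g / 2 + (if odd n then g else 0)) / x\<^sup>2"

text \<open>\<open>w\<close> is written through x^2 so that one formula is differentiable on both
  sides of 0. Its logarithmic derivative g/(2x) - x is half the first-order coefficient of the
  equation, which is why that term cancels.\<close>

lemma gen_hermite_liouville:
  fixes g :: real and n :: nat and p :: "real poly"
  assumes H: "g > -1" "n \<ge> 1" "gen_hermite g n p"
  defines "w \<equiv> \<lambda>x::real. (x\<^sup>2) powr (g / 4) * exp (- x\<^sup>2 / 2)"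
  defines "u' \<equiv> \<lambda>x. w x * (poly (pderiv p) x + (g / (2 * x) - x) * poly p x)"
  assumes x: "x \<noteq> 0"
  shows "((\<lambda>x. w x * poly p x) has_real_derivative u' x) (at x)"
    and "(u' has_real_derivative - hermite_potential g n x * (w x * poly p x)) (at x)"
proof -
  have powr: "(x\<^sup>2) powr (g / 4 - 1) * x\<^sup>2 = (x\<^sup>2) powr (g / 4)"
    using x by (simp add: powr_diff)
  have "(w has_real_derivative
      (g / 4 * (x\<^sup>2) powr (g / 4 - 1) * (2 * x)) * exp (- x\<^sup>2 / 2) +
      (x\<^sup>2) powr (g / 4) * (exp (- x\<^sup>2 / 2) * (- x))) (at x)"
    unfolding w_def using x by (auto intro!: derivative_eq_intros)
  also have "(g / 4 * (x\<^sup>2) powr (g / 4 - 1) * (2 * x)) * exp (- x\<^sup>2 / 2) +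
      (x\<^sup>2) powr (g / 4) * (exp (- x\<^sup>2 / 2) * (- x)) = w x * (g / (2 * x) - x)"
    unfolding w_def powr[symmetric] using x by (simp add: field_simps power2_eq_square)
  finally have w: "(w has_real_derivative w x * (g / (2 * x) - x)) (at x)" .
  show "((\<lambda>x. w x * poly p x) has_real_derivative u' x) (at x)"
    unfolding u'_def by (auto intro!: derivative_eq_intros w poly_DERIV simp: algebra_simps)
  define K where "K = (\<lambda>x. g / (2 * x) - x)"
  have K: "(K has_real_derivative - g / (2 * x\<^sup>2) - 1) (at x)"
    unfolding K_def using x by (auto intro!: derivative_eq_intros simp: power2_eq_square)
  have w': "(w has_real_derivative w x * K x) (at x)" using w by (simp add: K_def)
  have "((\<lambda>x. w x * (poly (pderiv p) x + K x * poly p x)) has_real_derivative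
      w x * (poly (pderiv (pderiv p)) x + 2 * K x * poly (pderiv p) x) +
      w x * ((K x)\<^sup>2 - g / (2 * x\<^sup>2) - 1) * poly p x) (at x)"
    by (auto intro!: derivative_eq_intros w' K poly_DERIV simp: algebra_simps power2_eq_square)
  also have "2 * K x = g / x - 2 * x" using x by (simp add: K_def field_simps)
  also have "poly (pderiv (pderiv p)) x + (g / x - 2 * x) * poly (pderiv p) x =
     - (2 * real n - (if odd n then g else 0) / x\<^sup>2) * poly p x"
    using gen_hermite_ode[OF H x] by linarith
  also have "(K x)\<^sup>2 = g\<^sup>2 / 4 / x\<^sup>2 - g + x\<^sup>2"
    using x by (simp add: K_def power2_diff power_divide power2_eq_square field_simps)
  also have "w x * (- (2 * real n - (if odd n then g else 0) / x\<^sup>2) * poly p x) +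
      w x * (g\<^sup>2 / 4 / x\<^sup>2 - g + x\<^sup>2 - g / (2 * x\<^sup>2) - 1) * poly p x =
      - hermite_potential g n x * (w x * poly p x)"
    unfolding hermite_potential_def by (simp add: algebra_simps add_divide_distrib diff_divide_distrib)
  finally show "(u' has_real_derivative - hermite_potential g n x * (w x * poly p x)) (at x)"
    unfolding u'_def K_def .
qed

text \<open>Sturm's argument would make \<open>p\<close> vanish on all of (a, b), giving infinitely
  many roots. The interval avoids 0, where the equation is singular.\<close>

lemma gen_hermite_no_zeros:
  fixes h h' :: "real \<Rightarrow> real"
  assumes H: "g > -1" "n \<ge> 1" "gen_hermite g n p"
    and ab: "a < b" "0 \<notin> {a..b}"
    and h: "\<And>x. a \<le> x \<Longrightarrow> x \<le> b \<Longrightarrow> (h has_real_derivative h' x) (at x)"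
    and less: "\<And>x. a \<le> x \<Longrightarrow> x \<le> b \<Longrightarrow> h' x < - hermite_potential g n x - (h x)\<^sup>2"
    and zero: "poly p a = 0" "poly p b = 0"
  shows False
proof -
  have "p \<noteq> 0" using H(3) by (simp add: gen_hermite_def orthogonal_poly_def)
  have "poly p x = 0" if x: "x \<in> {a<..<b}" for x
  proof -
    have "(x\<^sup>2) powr (g / 4) * exp (- x\<^sup>2 / 2) * poly p x = 0"
      by (rule sturm_zeros_unique[OF gen_hermite_liouville[OF H] h less])
        (use ab zero x in auto)
    then show ?thesis using x ab by auto
  qed
  then have "{a<..<b} \<subseteq> {x. poly p x = 0}" by blast
  then show False
    using poly_roots_finite[OF \<open>p \<noteq> 0\<close>] ab(1) finite_subset infinite_Ioo by blast
qed

text \<open>Comparison with a constant function, h = 0: solutions do not oscillate where the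
  potential is negative.\<close>

lemma gen_hermite_zero_unique:
  assumes "g > -1" "n \<ge> 1" "gen_hermite g n p" "a < b" "0 \<notin> {a..b}"
    and "\<And>x. a \<le> x \<Longrightarrow> x \<le> b \<Longrightarrow> hermite_potential g n x < 0"
    and "poly p a = 0" "poly p b = 0"
  shows False
  by (rule gen_hermite_no_zeros[OF assms(1-5), of "\<lambda>_. 0" "\<lambda>_. 0"]) (use assms in auto)

lemma gen_hermite_zeros_spacing:
  assumes H: "g > -1" "n \<ge> 1" "gen_hermite g n p" and ab: "a < b" "0 \<notin> {a..b}"
    and q: "\<And>x. a \<le> x \<Longrightarrow> x \<le> b \<Longrightarrow> hermite_potential g n x < \<omega>\<^sup>2" and \<omega>: "\<omega> > 0"
    and zero: "poly p a = 0" "poly p b = 0"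
  shows "b - a \<ge> pi / \<omega>"
proof (rule ccontr)
  assume "\<not> ?thesis"
  then have less: "\<omega> * (b - a) < pi" using \<omega> by (simp add: field_simps)
  \<comment> \<open>Centred at the midpoint, the interval of length below pi / \<omega> fits between
    two consecutive zeros of the cosine.\<close>
  define m where "m = (a + b) / 2"
  have small: "\<bar>\<omega> * (x - m)\<bar> < pi / 2" if "a \<le> x" "x \<le> b" for x
  proof -
    have "\<bar>x - m\<bar> \<le> (b - a) / 2" using that by (simp add: m_def abs_le_iff field_simps)
    then have "\<omega> * \<bar>x - m\<bar> \<le> \<omega> * ((b - a) / 2)" using \<omega> by (intro mult_left_mono) auto
    moreover have "\<bar>\<omega> * (x - m)\<bar> = \<omega> * \<bar>x - m\<bar>" using \<omega> by (simp add: abs_mult)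
    moreover have "\<omega> * ((b - a) / 2) = \<omega> * (b - a) / 2" by simp
    ultimately show ?thesis using less by linarith
  qed
  show False
    by (rule gen_hermite_no_zeros[OF H ab riccati_tan[OF small] _ zero]) (use q in auto)
qed

text \<open>The comparison function \<open>sqrt x * cos (\<omega> * (x - a))\<close>, whose logarithmic derivative is
  the \<open>h\<close> used below, absorbs the singular part of the potential, which is at most \<open>1 / (4 * x\<^sup>2)\<close> because
  \<open>g\<^sup>2 / 4 - g / 2 + 1 / 4\<close> and \<open>g\<^sup>2 / 4 + g / 2 + 1 / 4\<close> are squares.\<close>
lemma gen_hermite_zeros_spacing_pos:
  assumes H: "g > -1" "n \<ge> 1" "gen_hermite g n p" and ab: "0 < a" "a < b"
    and zero: "poly p a = 0" "poly p b = 0"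
  shows "b - a \<ge> pi / (2 * sqrt (2 * real n + g + 1))"
proof (rule ccontr)
  define \<omega> where "\<omega> = sqrt (2 * real n + g + 1)"
  have \<omega>: "\<omega> > 0" "\<omega>\<^sup>2 = 2 * real n + g + 1" using H by (auto simp: \<omega>_def)
  assume "\<not> ?thesis"
  then have less: "\<omega> * (b - a) < pi / 2" using \<omega> by (simp add: field_simps \<omega>_def)
  have range: "0 \<le> \<omega> * (x - a)" "\<omega> * (x - a) < pi / 2" if "a \<le> x" "x \<le> b" for x
  proof -
    have "\<omega> * (x - a) \<le> \<omega> * (b - a)" using that \<omega> by (intro mult_left_mono) auto
    then show "\<omega> * (x - a) < pi / 2" using less by simp
    show "0 \<le> \<omega> * (x - a)" using that \<omega> by simp
  qed
  \<comment> \<open>The cosine is centred at \<open>a\<close>, so that \<open>t\<close> is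
    nonpositive on the whole interval and the cross term t / x of the square has a favourable sign.
    Only a length of pi / (2 \<omega>) is then available, whence the 2 in the bound.\<close>
  define t where "t = (\<lambda>x. - \<omega> * tan (\<omega> * (x - a)))"
  have ab': "0 \<notin> {a..b}" using ab by auto
  show False
  proof (rule gen_hermite_no_zeros[OF H ab(2) ab' _ _ zero])
    fix x assume x: "a \<le> x" "x \<le> b"
    have "\<bar>\<omega> * (x - a)\<bar> < pi / 2" using range[OF x] by simp
    from riccati_tan[OF this]
    have "(t has_real_derivative - \<omega>\<^sup>2 - (t x)\<^sup>2) (at x)" by (simp only: t_def)
    moreover have "((\<lambda>x. 1 / (2 * x)) has_real_derivative - 1 / (2 * x\<^sup>2)) (at x)"
      using x ab by (auto intro!: derivative_eq_intros simp: power2_eq_square)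
    ultimately show "((\<lambda>x. 1 / (2 * x) + t x) has_real_derivative
        - 1 / (2 * x\<^sup>2) + (- \<omega>\<^sup>2 - (t x)\<^sup>2)) (at x)"
      by (intro DERIV_add)
    have "t x \<le> 0"
    proof (cases "x = a")
      case False
      then have "\<omega> * (x - a) > 0" using x \<omega> by simp
      then have "tan (\<omega> * (x - a)) > 0" using range[OF x] by (intro tan_gt_zero) auto
      then show ?thesis using \<omega> by (simp add: t_def)
    qed (simp add: t_def)
    then have "t x / x \<le> 0" using x ab by (intro divide_nonpos_pos) auto
    moreover have "(1 / (2 * x) + t x)\<^sup>2 = 1 / (4 * x\<^sup>2) + t x / x + (t x)\<^sup>2"
      using x ab by (simp add: power2_eq_square field_simps)
    moreover have "hermite_potential g n x < \<omega>\<^sup>2 + 1 / (4 * x\<^sup>2)"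
    proof -
      have "(g - 1)\<^sup>2 \<ge> 0" "(g + 1)\<^sup>2 \<ge> 0" by simp_all
      then have "- (1 / 4) \<le> g\<^sup>2 / 4 - g / 2 + (if odd n then g else 0)"
        by (auto simp: power2_eq_square algebra_simps)
      then have "- (1 / 4) / x\<^sup>2 \<le> (g\<^sup>2 / 4 - g / 2 + (if odd n then g else 0)) / x\<^sup>2"
        by (intro divide_right_mono) auto
      moreover have "x\<^sup>2 > 0" using x ab by simp
      moreover have "- (1 / 4) / x\<^sup>2 = - (1 / (4 * x\<^sup>2))" by simp
      ultimately show ?thesis unfolding hermite_potential_def \<omega>(2) by linarith
    qed
    \<comment> \<open>One half cancels the square of 1 / (2 x), the other pays for the singular part
      of the potential.\<close>
    moreover have "- 1 / (2 * x\<^sup>2) = - 1 / (4 * x\<^sup>2) - 1 / (4 * x\<^sup>2)" by simp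
    ultimately show "- 1 / (2 * x\<^sup>2) + (- \<omega>\<^sup>2 - (t x)\<^sup>2) <
        - hermite_potential g n x - (1 / (2 * x) + t x)\<^sup>2"
      by linarith
  qed
qed

lemma gen_hermite_zero_exists:
  assumes H: "g > -1" "n \<ge> 1" "gen_hermite g n p" and ab: "0 \<notin> {a..b}"
    and q: "\<And>x. a \<le> x \<Longrightarrow> x \<le> b \<Longrightarrow> hermite_potential g n x \<ge> \<omega>\<^sup>2"
    and \<omega>: "\<omega> > 0" "\<omega> * (b - a) \<ge> pi"
  shows "\<exists>x. a \<le> x \<and> x \<le> b \<and> poly p x = 0"
proof -
  have "\<exists>x. a \<le> x \<and> x \<le> b \<and> (x\<^sup>2) powr (g / 4) * exp (- x\<^sup>2 / 2) * poly p x = 0"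
    by (rule sturm_zero_exists[OF gen_hermite_liouville[OF H] q \<omega>]) (use ab in auto)
  then show ?thesis using ab by force
qed

section \<open>Counting zeros\<close>

lemma card_le_of_spacing:
  fixes S :: "real set"
  assumes S: "S \<subseteq> {a..b}" and D: "D > 0" and ab: "a \<le> b"
    and spacing: "\<And>x y. x \<in> S \<Longrightarrow> y \<in> S \<Longrightarrow> x < y \<Longrightarrow> D \<le> y - x"
  shows "real (card S) \<le> (b - a) / D + 1"
proof -
  define f where "f = (\<lambda>x. nat \<lfloor>(x - a) / D\<rfloor>)"
  have f_less: "f x < f y" if "x \<in> S" "y \<in> S" "x < y" for x y
  proof -
    have "(x - a) / D + 1 \<le> (y - a) / D"
    proof -
      have "1 \<le> (y - x) / D" using spacing[OF that] D by (simp add: pos_le_divide_eq)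
      then show ?thesis by (simp add: diff_divide_distrib)
    qed
    then have "\<lfloor>(x - a) / D\<rfloor> + 1 \<le> \<lfloor>(y - a) / D\<rfloor>" by linarith
    moreover have "0 \<le> (x - a) / D" using that S D by auto
    ultimately show ?thesis unfolding f_def by linarith
  qed
  have "inj_on f S"
    by (rule inj_onI) (metis f_less less_irrefl linorder_less_linear)
  moreover have "f ` S \<subseteq> {..nat \<lfloor>(b - a) / D\<rfloor>}"
    using S D by (auto simp: f_def intro!: nat_mono floor_mono divide_right_mono)
  ultimately have "card S \<le> card {..nat \<lfloor>(b - a) / D\<rfloor>}"
    by (intro card_inj_on_le) auto
  moreover have "0 \<le> (b - a) / D" using ab D by simp
  then have "real (nat \<lfloor>(b - a) / D\<rfloor>) \<le> (b - a) / D" by linarith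
  ultimately show ?thesis by simp
qed

text \<open>The cells are open on the left, so points picked from different cells are distinct. An
  incomplete last cell is given up, whence the -1.\<close>

lemma card_ge_of_cells:
  fixes S :: "real set"
  assumes S: "finite S" and D: "D > 0"
    and cell: "\<And>t. a \<le> t \<Longrightarrow> t + D \<le> b \<Longrightarrow> \<exists>x\<in>S. t < x \<and> x \<le> t + D"
  shows "real (card S) \<ge> (b - a) / D - 1"
proof -
  define n where "n = nat \<lfloor>(b - a) / D\<rfloor>"
  have "\<exists>x\<in>S. a + real k * D < x \<and> x \<le> a + real (Suc k) * D" if "k < n" for k
  proof -
    have "real (Suc k) \<le> (b - a) / D" using that unfolding n_def by linarith
    then have "real (Suc k) * D \<le> b - a" using D by (simp add: pos_le_divide_eq)
    moreover have "real (Suc k) * D = real k * D + D" by (simp add: algebra_simps)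
    ultimately show ?thesis using cell[of "a + real k * D"] D by (auto simp: add.assoc)
  qed
  then obtain z where z: "\<And>k. k < n \<Longrightarrow> z k \<in> S \<and> a + real k * D < z k \<and> z k \<le> a + real (Suc k) * D"
    by metis
  have z_less: "z j < z k" if "j < k" "k < n" for j k
  proof -
    have "real (Suc j) * D \<le> real k * D" using that D by (intro mult_right_mono) auto
    then show ?thesis using z[of j] z[of k] that by linarith
  qed
  have "inj_on z {..<n}"
    by (rule inj_onI) (metis lessThan_iff less_irrefl linorder_less_linear z_less)
  then have "card {..<n} \<le> card S"
    using z S by (intro card_inj_on_le[of z]) auto
  moreover have "(b - a) / D - 1 \<le> real n" unfolding n_def by linarith
  ultimately show ?thesis by simp
qed

lemma zero_count_diff:
  assumes "p \<noteq> 0" "a \<le> b"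
  shows "real (zero_count p b) - real (zero_count p a) = real (card {x. a < x \<and> x \<le> b \<and> poly p x = 0})"
proof -
  have fin: "finite {x. P x \<and> poly p x = 0}" for P
    by (rule finite_subset[OF _ poly_roots_finite[OF assms(1)]]) auto
  have "{x. x \<le> b \<and> poly p x = 0} =
      {x. x \<le> a \<and> poly p x = 0} \<union> {x. (a < x \<and> x \<le> b) \<and> poly p x = 0}"
    using assms(2) by auto
  then have "zero_count p b = zero_count p a + card {x. (a < x \<and> x \<le> b) \<and> poly p x = 0}"
    unfolding zero_count_def by (subst card_Un_disjoint[symmetric]) (use fin in auto)
  then show ?thesis by simp
qed

section \<open>Zero counts of one fixed polynomial on intervals\<close>

context
  fixes g :: real and n :: nat and p :: "real poly"
  assumes H: "g > -1" "n \<ge> 1" "gen_hermite g n p"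
begin

lemma gen_hermite_nonzero: "p \<noteq> 0"
  using H(3) by (simp add: gen_hermite_def orthogonal_poly_def)

lemma zero_count_diff_le:
  assumes ab: "a < b" "0 \<notin> {a..b}" and \<omega>: "\<omega> > 0"
    and q: "\<And>x. a \<le> x \<Longrightarrow> x \<le> b \<Longrightarrow> hermite_potential g n x < \<omega>\<^sup>2"
  shows "pi * (real (zero_count p b) - real (zero_count p a)) \<le> (b - a) * \<omega> + pi"
proof -
  let ?S = "{x. a < x \<and> x \<le> b \<and> poly p x = 0}"
  have "real (card ?S) \<le> (b - a) / (pi / \<omega>) + 1"
  proof (rule card_le_of_spacing)
    fix x y assume "x \<in> ?S" "y \<in> ?S" "x < y"
    then show "pi / \<omega> \<le> y - x"
      by (intro gen_hermite_zeros_spacing[OF H _ _ q \<omega>]) (use ab in auto)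
  qed (use \<omega> ab in auto)
  then have "pi * real (card ?S) \<le> pi * ((b - a) / (pi / \<omega>) + 1)" by (intro mult_left_mono) auto
  also have "\<dots> = (b - a) * \<omega> + pi" using \<omega> by (simp add: field_simps)
  finally show ?thesis using ab by (simp add: zero_count_diff gen_hermite_nonzero)
qed

text \<open>Sturm gives a zero in each closed interval of length pi / \<omega>, but disjoint cells
  must be half-open. The smaller frequency \<omega>' makes the cells slightly longer, and the closed
  interval is placed at their right end.\<close>

lemma zero_count_diff_ge:
  assumes ab: "a < b" "0 \<notin> {a..b}" and \<omega>: "0 < \<omega>'" "\<omega>' < \<omega>"
    and q: "\<And>x. a \<le> x \<Longrightarrow> x \<le> b \<Longrightarrow> hermite_potential g n x \<ge> \<omega>\<^sup>2"
  shows "pi * (real (zero_count p b) - real (zero_count p a)) \<ge> (b - a) * \<omega>' - pi"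
proof -
  let ?S = "{x. a < x \<and> x \<le> b \<and> poly p x = 0}"
  have less: "pi / \<omega> < pi / \<omega>'" using \<omega> by (simp add: field_simps)
  have "(b - a) / (pi / \<omega>') - 1 \<le> real (card ?S)"
  proof (rule card_ge_of_cells)
    show "finite ?S" by (rule finite_subset[OF _ poly_roots_finite[OF gen_hermite_nonzero]]) auto
    fix t assume t: "a \<le> t" "t + pi / \<omega>' \<le> b"
    have "\<exists>x. t + pi / \<omega>' - pi / \<omega> \<le> x \<and> x \<le> t + pi / \<omega>' \<and> poly p x = 0"
      by (rule gen_hermite_zero_exists[OF H _ q]) (use t ab less \<omega> in auto)
    then obtain x where "t + pi / \<omega>' - pi / \<omega> \<le> x" "x \<le> t + pi / \<omega>'" "poly p x = 0" by blast
    then show "\<exists>x\<in>?S. t < x \<and> x \<le> t + pi / \<omega>'"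
      using t less by (intro bexI[of _ x]) auto
  qed (use \<omega> in auto)
  then have "pi * ((b - a) / (pi / \<omega>') - 1) \<le> pi * real (card ?S)" by (intro mult_left_mono) auto
  also have "pi * ((b - a) / (pi / \<omega>') - 1) = (b - a) * \<omega>' - pi" using \<omega> by (simp add: field_simps)
  finally show ?thesis using ab by (simp add: zero_count_diff gen_hermite_nonzero)
qed

text \<open>Zeros on the negative half-line are reflected to the positive one, so 0 may lie in the
  interval. The 4 is the 2 of the spacing bound times two half-lines; the 3 is one extra zero per
  half-line and a possible zero at 0.\<close>

lemma zero_count_diff_crude:
  assumes ab: "a < b"
  shows "pi * (real (zero_count p b) - real (zero_count p a)) \<le>
    4 * (b - a) * sqrt (2 * real n + g + 1) + 3 * pi"
proof -
  let ?S = "{x. a < x \<and> x \<le> b \<and> poly p x = 0}"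
  define D where "D = pi / (2 * sqrt (2 * real n + g + 1))"
  have D: "D > 0" using H by (simp add: D_def)
  have neg: "poly p (- x) = 0" if "poly p x = 0" for x
    using that gen_hermite_neg[OF H] by simp
  have "real (card (?S \<inter> {0<..})) \<le> (b - a) / D + 1"
  proof (rule card_le_of_spacing[OF _ D])
    fix x y assume "x \<in> ?S \<inter> {0<..}" "y \<in> ?S \<inter> {0<..}" "x < y"
    then show "D \<le> y - x" unfolding D_def by (intro gen_hermite_zeros_spacing_pos[OF H]) auto
  qed (use ab in auto)
  moreover have "real (card (?S \<inter> {..<0})) \<le> (b - a) / D + 1"
  proof (rule card_le_of_spacing[OF _ D])
    fix x y assume "x \<in> ?S \<inter> {..<0}" "y \<in> ?S \<inter> {..<0}" "x < y"
    then have "D \<le> - x - (- y)"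
      unfolding D_def by (intro gen_hermite_zeros_spacing_pos[OF H]) (auto intro: neg)
    then show "D \<le> y - x" by simp
  qed (use ab in auto)
  moreover have "card ?S \<le> card (?S \<inter> {0<..}) + card (?S \<inter> {..<0}) + 1"
  proof -
    have fin: "finite ?S" by (rule finite_subset[OF _ poly_roots_finite[OF gen_hermite_nonzero]]) auto
    have "?S \<subseteq> insert 0 (?S \<inter> {0<..} \<union> ?S \<inter> {..<0})" by auto
    then have "card ?S \<le> card (insert 0 (?S \<inter> {0<..} \<union> ?S \<inter> {..<0}))"
      using fin by (intro card_mono) auto
    also have "\<dots> \<le> Suc (card (?S \<inter> {0<..} \<union> ?S \<inter> {..<0}))" by (rule card_insert_le_m1) auto
    also have "\<dots> \<le> Suc (card (?S \<inter> {0<..}) + card (?S \<inter> {..<0}))" by (simp add: card_Un_le)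
    finally show ?thesis by simp
  qed
  ultimately have "real (card ?S) \<le> 2 * ((b - a) / D) + 3" by linarith
  then have "pi * real (card ?S) \<le> pi * (2 * ((b - a) / D) + 3)" by (intro mult_left_mono) auto
  also have "\<dots> = 4 * (b - a) * sqrt (2 * real n + g + 1) + 3 * pi"
    by (simp add: D_def field_simps)
  finally show ?thesis using ab by (simp add: zero_count_diff gen_hermite_nonzero)
qed

lemma zero_count_le_1:
  assumes "A < 0" and q: "\<And>x. x \<le> A \<Longrightarrow> hermite_potential g n x < 0"
  shows "zero_count p A \<le> 1"
proof -
  let ?S = "{x. x \<le> A \<and> poly p x = 0}"
  have "x = y" if "x \<in> ?S" "y \<in> ?S" for x y
  proof -
    have "\<not> x < y" if "x \<in> ?S" "y \<in> ?S" for x y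
      using gen_hermite_zero_unique[OF H _ _ q, of x y] that assms(1) by auto
    then show ?thesis using that by (meson linorder_cases)
  qed
  then have "card ?S \<le> Suc 0"
    by (subst card_le_Suc0_iff_eq)
      (auto intro: finite_subset[OF _ poly_roots_finite[OF gen_hermite_nonzero]])
  then show ?thesis by (simp add: zero_count_def)
qed

end

section \<open>The limit density\<close>

definition limit_potential :: "real \<Rightarrow> real \<Rightarrow> real" where
  "limit_potential c x = 2 + c - x\<^sup>2 - c\<^sup>2 / 4 / x\<^sup>2"

definition limit_density :: "real \<Rightarrow> real \<Rightarrow> real" where
  "limit_density c x =
     sqrt ((c + 1) - \<bar>x\<^sup>2 - c / 2 - 1\<bar>\<^sup>2) / \<bar>x\<bar> * indicator (closure (E1 c)) x"

text \<open>The radicand is x^2 times \<open>limit_potential c x\<close>. It is nonnegative on the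
  closure of \<open>E1 c\<close> and nonpositive off it, so the indicator and \<open>max 0\<close>
  cut off the same part; the cut matters because \<open>sqrt\<close> of a negative number is
  negative.\<close>

lemma limit_density_eq:
  assumes c: "c \<ge> 0" and x: "x \<noteq> 0"
  shows "limit_density c x = sqrt (max 0 (limit_potential c x))"
proof -
  let ?W = "(c + 1) - (x\<^sup>2 - c / 2 - 1)\<^sup>2"
  have W: "?W / x\<^sup>2 = limit_potential c x"
    using x by (simp add: limit_potential_def field_simps power2_eq_square)
  show ?thesis
  proof (cases "x \<in> closure (E1 c)")
    case True
    have "closed {x::real. \<bar>x\<^sup>2 - c / 2 - 1\<bar> \<le> sqrt (c + 1)}"
      by (intro closed_Collect_le continuous_intros)
    then have "closure (E1 c) \<subseteq> {x. \<bar>x\<^sup>2 - c / 2 - 1\<bar> \<le> sqrt (c + 1)}"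
      by (intro closure_minimal) (auto simp: E1_def)
    with True have "\<bar>x\<^sup>2 - c / 2 - 1\<bar> \<le> sqrt (c + 1)" by auto
    then have "(x\<^sup>2 - c / 2 - 1)\<^sup>2 \<le> c + 1"
      using c by (metis add_nonneg_nonneg real_sqrt_abs real_sqrt_le_iff zero_le_one)
    then have "?W / x\<^sup>2 \<ge> 0" by simp
    moreover have "sqrt ?W / \<bar>x\<bar> = sqrt (?W / x\<^sup>2)" by (simp add: real_sqrt_divide)
    ultimately show ?thesis using True by (simp add: limit_density_def W)
  next
    case False
    then have "x \<notin> E1 c" using closure_subset by blast
    then have "sqrt (c + 1) \<le> \<bar>x\<^sup>2 - c / 2 - 1\<bar>" by (simp add: E1_def)
    then have "c + 1 \<le> (x\<^sup>2 - c / 2 - 1)\<^sup>2"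
      by (metis real_sqrt_abs real_sqrt_le_iff)
    then have "?W / x\<^sup>2 \<le> 0" by (intro divide_nonpos_nonneg) auto
    then show ?thesis using False by (simp add: limit_density_def W)
  qed
qed

lemma limit_density_0 [simp]: "limit_density c 0 = 0"
  by (simp add: limit_density_def)

lemma limit_density_nonneg: "c \<ge> 0 \<Longrightarrow> limit_density c x \<ge> 0"
  by (cases "x = 0") (auto simp: limit_density_eq)

lemma limit_density_le:
  assumes "c \<ge> 0"
  shows "limit_density c x \<le> sqrt (c + 2)"
proof (cases "x = 0")
  case False
  have "0 \<le> x\<^sup>2" "0 \<le> c\<^sup>2 / 4 / x\<^sup>2" by simp_all
  then have "limit_potential c x \<le> c + 2" unfolding limit_potential_def by linarith
  then show ?thesis using assms False by (simp add: limit_density_eq)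
qed (use assms in auto)

lemma limit_density_far:
  assumes c: "c \<ge> 0" and x: "c + 4 \<le> \<bar>x\<bar>"
  shows "limit_density c x = 0"
proof -
  have "1 * (c + 4) \<le> \<bar>x\<bar> * \<bar>x\<bar>" using c x by (intro mult_mono) auto
  then have "c + 4 \<le> x\<^sup>2" by (simp add: power2_eq_square)
  moreover have "0 \<le> c\<^sup>2 / 4 / x\<^sup>2" by simp
  ultimately have "limit_potential c x \<le> 0" unfolding limit_potential_def by linarith
  then show ?thesis using c x by (subst limit_density_eq) auto
qed

text \<open>At 0 this can fail: for c = 0 the density tends to sqrt 2 there, while division by zero
  sets its value to 0.\<close>

lemma isCont_limit_density:
  assumes c: "c \<ge> 0" and x: "x \<noteq> 0"
  shows "isCont (limit_density c) x"
proof -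
  have "isCont (\<lambda>x. sqrt (max 0 (limit_potential c x))) x"
    unfolding limit_potential_def using x by (intro continuous_intros) auto
  moreover have ev: "\<forall>\<^sub>F y in nhds x. limit_density c y = sqrt (max 0 (limit_potential c y))"
    using t1_space_nhds[OF x] by eventually_elim (simp add: limit_density_eq[OF c])
  ultimately show ?thesis by (simp only: isCont_cong[OF ev])
qed

lemma integrable_limit_density:
  assumes c: "c \<ge> 0"
  shows "integrable lborel (limit_density c)"
proof -
  let ?K = "{- (c + 4)..c + 4}"
  have "integrable lborel (\<lambda>x. indicator ?K x *\<^sub>R sqrt (c + 2))"
    by (intro integrable_scaleR_left integrable_real_indicator) (auto simp: emeasure_lborel_Icc_eq)
  then show ?thesis
  proof (rule Bochner_Integration.integrable_bound)
    have [measurable]: "closure (E1 c) \<in> sets borel" by (intro borel_closed) simp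
    show "limit_density c \<in> borel_measurable lborel"
      unfolding limit_density_def by measurable
    show "AE x in lborel. norm (limit_density c x) \<le> norm (indicator ?K x *\<^sub>R sqrt (c + 2))"
      using c limit_density_far[OF c] limit_density_nonneg[OF c] limit_density_le[OF c]
      by (intro AE_I2) (auto simp: indicator_def abs_le_iff not_le)
  qed
qed

definition limit_cdf :: "real \<Rightarrow> real \<Rightarrow> real" where
  "limit_cdf c y = (LINT x:{..y}|lborel. limit_density c x)"

lemma limit_cdf_diff:
  assumes c: "c \<ge> 0" and ab: "a \<le> b"
    and bounds: "\<And>x. a < x \<Longrightarrow> x \<le> b \<Longrightarrow> lo \<le> limit_density c x"
      "\<And>x. a < x \<Longrightarrow> x \<le> b \<Longrightarrow> limit_density c x \<le> hi"
  shows "lo * (b - a) \<le> limit_cdf c b - limit_cdf c a"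
    and "limit_cdf c b - limit_cdf c a \<le> hi * (b - a)"
proof -
  have int: "set_integrable lborel S (limit_density c)" if "S \<in> sets borel" for S
    unfolding set_integrable_def using that
    by (intro integrable_mult_indicator integrable_limit_density[OF c]) auto
  have "{..b} = {..a} \<union> {a<..b}" using ab by auto
  then have eq: "limit_cdf c b - limit_cdf c a = (LINT x:{a<..b}|lborel. limit_density c x)"
    unfolding limit_cdf_def by (subst (1) \<open>{..b} = _\<close>, subst set_integral_Un) (auto intro: int)
  have const: "set_integrable lborel {a<..b} (\<lambda>x. k)" "(LINT x:{a<..b}|lborel. k) = k * (b - a)" for k :: real
    using ab by (auto simp: set_integrable_def set_lebesgue_integral_def)
  show "lo * (b - a) \<le> limit_cdf c b - limit_cdf c a"
    unfolding eq const(2)[symmetric] by (rule set_integral_mono) (use bounds in \<open>auto intro: int const\<close>)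
  show "limit_cdf c b - limit_cdf c a \<le> hi * (b - a)"
    unfolding eq const(2)[symmetric] by (rule set_integral_mono) (use bounds in \<open>auto intro: int const\<close>)
qed

lemma limit_cdf_far:
  assumes "c \<ge> 0" "A \<le> - (c + 4)"
  shows "limit_cdf c A = 0"
proof -
  have "indicator {..A} x *\<^sub>R limit_density c x = 0" for x
    using limit_density_far[OF assms(1), of x] assms by (auto simp: indicator_def)
  then show ?thesis unfolding limit_cdf_def set_lebesgue_integral_def by (simp only: Bochner_Integration.integral_zero)
qed

section \<open>Convergence of the counting function\<close>

lemma eventually_const_le_mult:
  assumes "e > 0"
  shows "\<forall>\<^sub>F l in sequentially. k \<le> real l * e"
  using eventually_ge_at_top[of "nat \<lceil>k / e\<rceil>"]
proof eventually_elim
  case (elim l)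
  then have "k / e \<le> real l" by linarith
  then show ?case using assms by (simp add: pos_divide_le_eq)
qed

context
  fixes \<gamma> :: "nat \<Rightarrow> real" and c :: real and H :: "nat \<Rightarrow> real poly"
  assumes \<gamma>: "\<And>l. l \<ge> 1 \<Longrightarrow> \<gamma> l > -1"
    and lim: "(\<lambda>l. \<gamma> l / real l) \<longlonglongrightarrow> c"
    and c: "c \<ge> 0"
    and H: "\<And>l. l \<ge> 1 \<Longrightarrow> gen_hermite (\<gamma> l) l (H l)"
begin

abbreviation (input) zeros :: "nat \<Rightarrow> real \<Rightarrow> real" where
  "zeros l y \<equiv> real (zero_count (H l) (sqrt (real l) * y))"

abbreviation (input) potential :: "nat \<Rightarrow> real \<Rightarrow> real" where
  "potential l x \<equiv> hermite_potential (\<gamma> l) l (sqrt (real l) * x)"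

text \<open>Only the square of \<open>\<gamma> l\<close> can grow like l^2; the linear terms, and
  with them the parity of \<open>l\<close>, disappear in the limit.\<close>

lemma centrifugal_tendsto:
  "(\<lambda>l. ((\<gamma> l)\<^sup>2 / 4 - \<gamma> l / 2 + (if odd l then \<gamma> l else 0)) / (real l)\<^sup>2) \<longlonglongrightarrow> c\<^sup>2 / 4"
proof -
  have small: "(\<lambda>l. \<gamma> l / real l * (1 / real l)) \<longlonglongrightarrow> 0"
    using tendsto_mult[OF lim lim_1_over_n] by simp
  have "(\<lambda>l. if odd l then \<gamma> l / real l * (1 / real l) else 0) \<longlonglongrightarrow> 0"
    by (rule Lim_null_comparison[OF _ tendsto_rabs_zero[OF small]]) auto
  from tendsto_add[OF tendsto_diff[OF tendsto_divide[OF tendsto_power[OF lim, of 2] tendsto_const[of 4]]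
        tendsto_divide[OF small tendsto_const[of 2]]] this]
  have "(\<lambda>l. (\<gamma> l / real l)\<^sup>2 / 4 - \<gamma> l / real l * (1 / real l) / 2 +
      (if odd l then \<gamma> l / real l * (1 / real l) else 0)) \<longlonglongrightarrow> c\<^sup>2 / 4"
    by simp
  also have "(\<lambda>l. (\<gamma> l / real l)\<^sup>2 / 4 - \<gamma> l / real l * (1 / real l) / 2 +
      (if odd l then \<gamma> l / real l * (1 / real l) else 0)) =
      (\<lambda>l. ((\<gamma> l)\<^sup>2 / 4 - \<gamma> l / 2 + (if odd l then \<gamma> l else 0)) / (real l)\<^sup>2)"
    by (auto simp: fun_eq_iff power_divide power2_eq_square add_divide_distrib diff_divide_distrib)
  finally show ?thesis .
qed

text \<open>A joint limit in \<open>l\<close> and \<open>s\<close>, because Sturm comparison needs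
  bounds that are uniform on a short interval around x.\<close>

lemma potential_tendsto:
  assumes x: "x \<noteq> 0"
  shows "((\<lambda>(l, s). potential l s / real l) \<longlongrightarrow> limit_potential c x) (sequentially \<times>\<^sub>F nhds x)"
proof -
  let ?F = "sequentially \<times>\<^sub>F nhds x"
  let ?\<kappa> = "\<lambda>l. ((\<gamma> l)\<^sup>2 / 4 - \<gamma> l / 2 + (if odd l then \<gamma> l else 0)) / (real l)\<^sup>2"
  have fst: "filterlim fst sequentially ?F" and snd: "(snd \<longlongrightarrow> x) ?F"
    by (rule filterlim_fst filterlim_snd)+
  have "((\<lambda>z. 2 + \<gamma> (fst z) / real (fst z) + 1 / real (fst z) - (snd z)\<^sup>2 -
      ?\<kappa> (fst z) / (snd z)\<^sup>2) \<longlongrightarrow> 2 + c + 0 - x\<^sup>2 - c\<^sup>2 / 4 / x\<^sup>2) ?F"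
    using x by (intro tendsto_intros snd filterlim_compose[OF lim fst]
        filterlim_compose[OF lim_1_over_n fst] filterlim_compose[OF centrifugal_tendsto fst]) auto
  moreover have "\<forall>\<^sub>F z in ?F. 2 + \<gamma> (fst z) / real (fst z) + 1 / real (fst z) - (snd z)\<^sup>2 -
      ?\<kappa> (fst z) / (snd z)\<^sup>2 = (case z of (l, s) \<Rightarrow> potential l s / real l)"
    using filterlim_iff[THEN iffD1, OF fst, rule_format, OF eventually_gt_at_top[of 0]]
  proof eventually_elim
    case (elim z)
    define l s where "l = fst z" "s = snd z"
    have l: "real l > 0" using elim by (simp add: l_s_def)
    have k: "k / (sqrt (real l) * s)\<^sup>2 / real l = k / (real l)\<^sup>2 / s\<^sup>2" for k
      by (simp add: power_mult_distrib power2_eq_square)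
    have "(2 * real l + \<gamma> l + 1) / real l = 2 + \<gamma> l / real l + 1 / real l"
      "(sqrt (real l) * s)\<^sup>2 / real l = s\<^sup>2"
      using l by (simp_all add: add_divide_distrib power_mult_distrib)
    then have "potential l s / real l = 2 + \<gamma> l / real l + 1 / real l - s\<^sup>2 - ?\<kappa> l / s\<^sup>2"
      unfolding hermite_potential_def diff_divide_distrib[of _ _ "real l"] k by simp
    then show ?case by (simp add: l_s_def case_prod_beta)
  qed
  ultimately have "((\<lambda>(l, s). potential l s / real l) \<longlongrightarrow> 2 + c + 0 - x\<^sup>2 - c\<^sup>2 / 4 / x\<^sup>2) ?F"
    by (rule Lim_transform_eventually)
  then show ?thesis by (simp add: limit_potential_def)
qed

lemma potential_locally_bounded:
  assumes x: "x \<noteq> 0"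
  shows "limit_potential c x < M \<Longrightarrow>
      \<exists>d>0. \<forall>\<^sub>F l in sequentially. \<forall>s. \<bar>s - x\<bar> < d \<longrightarrow> potential l s < real l * M"
    and "m < limit_potential c x \<Longrightarrow>
      \<exists>d>0. \<forall>\<^sub>F l in sequentially. \<forall>s. \<bar>s - x\<bar> < d \<longrightarrow> potential l s > real l * m"
proof -
  have *: "\<exists>d>0. \<forall>\<^sub>F l in sequentially. \<forall>s. \<bar>s - x\<bar> < d \<longrightarrow> P (potential l s / real l)"
    if P: "\<forall>\<^sub>F z in sequentially \<times>\<^sub>F nhds x. P (case z of (l, s) \<Rightarrow> potential l s / real l)" for P
  proof -
    obtain P1 P2 where P1: "eventually P1 sequentially" and P2: "eventually P2 (nhds x)"
      and P: "\<And>l s. P1 l \<Longrightarrow> P2 s \<Longrightarrow> P (potential l s / real l)"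
      using P unfolding eventually_prod_filter by auto
    obtain d where d: "d > 0" "\<And>s. dist s x < d \<Longrightarrow> P2 s"
      using P2 unfolding eventually_nhds_metric by blast
    have "\<forall>\<^sub>F l in sequentially. \<forall>s. \<bar>s - x\<bar> < d \<longrightarrow> P (potential l s / real l)"
      using P1 by eventually_elim (use d P in \<open>auto simp: dist_real_def\<close>)
    then show ?thesis using d(1) by blast
  qed
  {
    assume "limit_potential c x < M"
    from *[OF order_tendstoD(2)[OF potential_tendsto[OF x] this]]
    obtain d where d: "d > 0"
      "\<forall>\<^sub>F l in sequentially. \<forall>s. \<bar>s - x\<bar> < d \<longrightarrow> potential l s / real l < M" by blast
    have "\<forall>\<^sub>F l in sequentially. \<forall>s. \<bar>s - x\<bar> < d \<longrightarrow> potential l s < real l * M"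
      using d(2) eventually_gt_at_top[of 0] by eventually_elim (auto simp: field_simps)
    then show "\<exists>d>0. \<forall>\<^sub>F l in sequentially. \<forall>s. \<bar>s - x\<bar> < d \<longrightarrow> potential l s < real l * M"
      using d(1) by blast
  }
  {
    assume "m < limit_potential c x"
    from *[OF order_tendstoD(1)[OF potential_tendsto[OF x] this]]
    obtain d where d: "d > 0"
      "\<forall>\<^sub>F l in sequentially. \<forall>s. \<bar>s - x\<bar> < d \<longrightarrow> potential l s / real l > m" by blast
    have "\<forall>\<^sub>F l in sequentially. \<forall>s. \<bar>s - x\<bar> < d \<longrightarrow> potential l s > real l * m"
      using d(2) eventually_gt_at_top[of 0] by eventually_elim (auto simp: field_simps)
    then show "\<exists>d>0. \<forall>\<^sub>F l in sequentially. \<forall>s. \<bar>s - x\<bar> < d \<longrightarrow> potential l s > real l * m"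
      using d(1) by blast
  }
qed

text \<open>The constant c + 4 collects 2 from the degree, c + 1 from
  \<open>\<gamma> l / real l\<close>, and 1 because 1 \<le> l.\<close>

lemma eventually_coefficient_le:
  "\<forall>\<^sub>F l in sequentially. 2 * real l + \<gamma> l + 1 \<le> real l * (c + 4)"
proof -
  have "\<forall>\<^sub>F l in sequentially. \<gamma> l / real l < c + 1"
    by (rule order_tendstoD(2)[OF lim]) simp
  then show ?thesis using eventually_gt_at_top[of 0]
    by eventually_elim (auto simp: field_simps)
qed

text \<open>Beyond this radius x^2 \<ge> l (c + 4)^2 outweighs the other terms, the potential is
  negative, and the single zero that may remain is negligible after division by
  \<open>l\<close>.\<close>

lemma eventually_zeros_far:
  assumes "A \<le> - (c + 4)"
  shows "\<forall>\<^sub>F l in sequentially. zeros l A \<le> 1"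
  using eventually_coefficient_le eventually_gt_at_top[of 0]
proof eventually_elim
  case (elim l)
  let ?A = "sqrt (real l) * A"
  have A: "A < 0" using assms c by simp
  have "zero_count (H l) ?A \<le> 1"
  proof (rule zero_count_le_1)
    show "- 1 < \<gamma> l" "1 \<le> l" "gen_hermite (\<gamma> l) l (H l)" using elim \<gamma> H by auto
    show "?A < 0" using A elim by (simp add: mult_less_0_iff)
    fix x assume x: "x \<le> ?A"
    have "sqrt (real l) * (c + 4) \<le> \<bar>x\<bar>"
    proof -
      have "sqrt (real l) * A \<le> sqrt (real l) * (- (c + 4))"
        using assms by (intro mult_left_mono) auto
      with x have "x \<le> - (sqrt (real l) * (c + 4))" by (simp only: mult_minus_right)
      then show ?thesis by linarith
    qed
    then have "(sqrt (real l) * (c + 4))\<^sup>2 \<le> \<bar>x\<bar>\<^sup>2" using c by (intro power_mono) auto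
    then have x2: "real l * (c + 4)\<^sup>2 \<le> x\<^sup>2" by (simp add: power_mult_distrib)
    have "real l * (4 * (c + 4)) \<le> real l * (c + 4)\<^sup>2"
      unfolding power2_eq_square using c by (intro mult_left_mono mult_right_mono) auto
    then have x2': "real l * (c + 4) + 1 < x\<^sup>2" "1 \<le> x\<^sup>2"
    proof -
      have "1 * 4 \<le> real l * (c + 4)" using elim c by (intro mult_mono) auto
      with \<open>real l * (4 * (c + 4)) \<le> real l * (c + 4)\<^sup>2\<close> x2
      show "real l * (c + 4) + 1 < x\<^sup>2" "1 \<le> x\<^sup>2" by linarith+
    qed
    let ?k = "(\<gamma> l)\<^sup>2 / 4 - \<gamma> l / 2 + (if odd l then \<gamma> l else 0)"
    have "(\<gamma> l - 1)\<^sup>2 \<ge> 0" "(\<gamma> l + 1)\<^sup>2 \<ge> 0" by simp_all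
    then have k: "- 1 \<le> ?k"
      by (auto simp: power2_eq_square algebra_simps)
    have "- x\<^sup>2 \<le> ?k" using k x2'(2) by linarith
    then have "- 1 \<le> ?k / x\<^sup>2"
      using x2' by (subst pos_le_divide_eq) auto
    then show "hermite_potential (\<gamma> l) l x < 0"
      using elim x2'(1) unfolding hermite_potential_def by linarith
  qed
  then show ?case by simp
qed

text \<open>The radius \<open>d\<close> precedes \<open>a\<close> and \<open>b\<close>, as bisection
  requires, while the threshold on \<open>l\<close> may depend on them. The 4 e consist of at most 2
  e from the frequency, e from the density, and e absorbing the boundary term pi.\<close>

lemma zeros_local:
  assumes x: "x \<noteq> 0" and e: "e > 0"
  shows "\<exists>d>0. \<forall>a b. a \<le> x \<and> x \<le> b \<and> b - a < d \<longrightarrow>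
    (\<forall>\<^sub>F l in sequentially. \<bar>pi * (zeros l b - zeros l a) -
      real l * (limit_cdf c b - limit_cdf c a)\<bar> \<le> real l * (4 * e * (b - a)))"
proof -
  define r where "r = limit_density c x"
  have r: "r \<ge> 0" "r = sqrt (max 0 (limit_potential c x))"
    using x c by (auto simp: r_def limit_density_nonneg limit_density_eq)
  have r2: "r\<^sup>2 = max 0 (limit_potential c x)" by (simp add: r(2))
  have "r\<^sup>2 < (r + e)\<^sup>2" using r(1) e by (intro power_strict_mono) auto
  then have "limit_potential c x < (r + e)\<^sup>2" using r2 by simp
  from potential_locally_bounded(1)[OF x this]
  obtain d1 where d1: "d1 > 0"
    "\<forall>\<^sub>F l in sequentially. \<forall>s. \<bar>s - x\<bar> < d1 \<longrightarrow> potential l s < real l * (r + e)\<^sup>2" by blast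
  \<comment> \<open>The frequency r - e is usable only when positive; otherwise the lower estimate
    will come from monotonicity of the count.\<close>
  obtain d2 where d2: "d2 > 0" "\<forall>\<^sub>F l in sequentially. \<forall>s. \<bar>s - x\<bar> < d2 \<longrightarrow>
      r > e \<longrightarrow> potential l s > real l * (r - e)\<^sup>2"
  proof (cases "r > e")
    case True
    then have "(r - e)\<^sup>2 < r\<^sup>2" using e by (intro power_strict_mono) auto
    moreover have "(0::real) \<le> (r - e)\<^sup>2" by simp
    ultimately have "(r - e)\<^sup>2 < limit_potential c x" using r2 by linarith
    from potential_locally_bounded(2)[OF x this] obtain d where "d > 0"
      "\<forall>\<^sub>F l in sequentially. \<forall>s. \<bar>s - x\<bar> < d \<longrightarrow> potential l s > real l * (r - e)\<^sup>2" by blast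
    then show ?thesis by (intro that[of d]) (auto elim!: eventually_mono)
  next
    case False
    then show ?thesis using that[of 1] by simp
  qed
  obtain d3 where d3: "d3 > 0" "\<And>s. \<bar>s - x\<bar> < d3 \<Longrightarrow> \<bar>limit_density c s - r\<bar> < e"
    using isCont_limit_density[OF c x] e unfolding continuous_at_eps_delta r_def by (metis dist_real_def)
  \<comment> \<open>The bound by |x| keeps 0 out of [a, b].\<close>
  define d where "d = min (min d1 d2) (min d3 \<bar>x\<bar>)"
  have d: "d > 0" "d \<le> d1" "d \<le> d2" "d \<le> d3" "d \<le> \<bar>x\<bar>" using d1 d2 d3 x by (auto simp: d_def)
  have "\<forall>\<^sub>F l in sequentially. \<bar>pi * (zeros l b - zeros l a) -
      real l * (limit_cdf c b - limit_cdf c a)\<bar> \<le> real l * (4 * e * (b - a))"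
    if ab: "a \<le> x" "x \<le> b" "b - a < d" for a b
  proof (cases "a = b")
    case False
    then have less: "a < b" using ab by simp
    have near: "\<bar>s - x\<bar> < d" if "a \<le> s" "s \<le> b" for s using ab that by auto
    have cdf: "(r - e) * (b - a) \<le> limit_cdf c b - limit_cdf c a"
      "limit_cdf c b - limit_cdf c a \<le> (r + e) * (b - a)"
    proof -
      have "\<bar>limit_density c s - r\<bar> < e" if "a < s" "s \<le> b" for s
        using d3(2)[of s] near[of s] d that by auto
      then have *: "r - e \<le> limit_density c s" "limit_density c s \<le> r + e" if "a < s" "s \<le> b" for s
        using that by (fastforce simp: abs_less_iff)+
      show "(r - e) * (b - a) \<le> limit_cdf c b - limit_cdf c a"
        "limit_cdf c b - limit_cdf c a \<le> (r + e) * (b - a)"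
        using limit_cdf_diff[OF c _ *] less by auto
    qed
    have "e * (b - a) > 0" using e less by simp
    from d1(2) d2(2) eventually_const_le_mult[OF this, of pi] eventually_gt_at_top[of 0]
    show ?thesis
    proof eventually_elim
      case (elim l)
      define L where "L = sqrt (real l)"
      have L: "L > 0" "L * L = real l" using elim by (auto simp: L_def)
      have H': "\<gamma> l > - 1" "1 \<le> l" "gen_hermite (\<gamma> l) l (H l)" using elim \<gamma> H by auto
      have zero: "0 \<notin> {L * a..L * b}"
      proof
        assume "0 \<in> {L * a..L * b}"
        then have "a \<le> 0" "0 \<le> b" using L(1) by (auto simp: mult_le_0_iff zero_le_mult_iff)
        then show False using near[of 0] d by simp
      qed
      have scaled: "a \<le> t / L \<and> t / L \<le> b \<and> t = L * (t / L)" if "L * a \<le> t" "t \<le> L * b" for t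
        using that L(1) by (simp add: field_simps)
      have upper: "pi * (zeros l b - zeros l a) \<le> (L * b - L * a) * (L * (r + e)) + pi"
        unfolding L_def[symmetric]
      proof (rule zero_count_diff_le[OF H' _ zero])
        show "L * a < L * b" "0 < L * (r + e)" using L less r(1) e by (auto intro: mult_pos_pos)
        fix t assume "L * a \<le> t" "t \<le> L * b"
        then obtain s where s: "a \<le> s" "s \<le> b" "t = L * s" using scaled by blast
        then have "potential l s < real l * (r + e)\<^sup>2" using elim(1) near[of s] d by auto
        then show "hermite_potential (\<gamma> l) l t < (L * (r + e))\<^sup>2"
          using L by (simp add: s(3) L_def power_mult_distrib)
      qed
      \<comment> \<open>r - 2 e and not r - e: counting from below needs a frequency strictly
        smaller than the one that bounds the potential.\<close>
      have lower: "pi * (zeros l b - zeros l a) \<ge> (L * b - L * a) * (L * (r - 2 * e)) - pi"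
      proof (cases "r > 2 * e")
        case True
        show ?thesis unfolding L_def[symmetric]
        proof (rule zero_count_diff_ge[OF H' _ zero])
          show "L * a < L * b" "0 < L * (r - 2 * e)" "L * (r - 2 * e) < L * (r - e)"
            using L less e True by auto
          fix t assume "L * a \<le> t" "t \<le> L * b"
          then obtain s where s: "a \<le> s" "s \<le> b" "t = L * s" using scaled by blast
          then have "potential l s > real l * (r - e)\<^sup>2" using elim(2) near[of s] d True e by auto
          then show "hermite_potential (\<gamma> l) l t \<ge> (L * (r - e))\<^sup>2"
            using L by (simp add: s(3) L_def power_mult_distrib)
        qed
      next
        case False
        have "zeros l b - zeros l a \<ge> 0"
          using gen_hermite_nonzero[OF H'] L less by (simp add: zero_count_diff L_def[symmetric])
        then have "pi * (zeros l b - zeros l a) \<ge> 0" by simp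
        moreover have "(L * b - L * a) * (L * (r - 2 * e)) \<le> 0"
          using False L less by (intro mult_nonneg_nonpos) auto
        ultimately show ?thesis using pi_gt_zero by linarith
      qed
      have expand: "(L * b - L * a) * (L * k) = real l * (k * (b - a))" for k
        unfolding L(2)[symmetric] by (simp add: algebra_simps)
      have "real l * ((r - e) * (b - a)) \<le> real l * (limit_cdf c b - limit_cdf c a)"
        "real l * (limit_cdf c b - limit_cdf c a) \<le> real l * ((r + e) * (b - a))"
        using cdf by (auto intro!: mult_left_mono)
      then show ?case
        using upper lower elim(3) unfolding expand by (simp add: algebra_simps abs_le_iff)
    qed
  qed simp
  then show ?thesis using d(1) by blast
qed

text \<open>Meant for intervals around 0. The 5 is the 4 of the crude count plus 1 that absorbs 3 pi
  for large \<open>l\<close>.\<close>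

lemma zeros_local_crude:
  assumes ab: "a < b"
  shows "\<forall>\<^sub>F l in sequentially. \<bar>pi * (zeros l b - zeros l a) -
      real l * (limit_cdf c b - limit_cdf c a)\<bar> \<le> real l * (5 * sqrt (c + 4) * (b - a))"
proof -
  have cdf: "0 \<le> limit_cdf c b - limit_cdf c a"
    "limit_cdf c b - limit_cdf c a \<le> sqrt (c + 4) * (b - a)"
  proof -
    have "limit_density c s \<le> sqrt (c + 4)" for s
      using limit_density_le[OF c, of s] by (rule order_trans) simp
    then show "0 \<le> limit_cdf c b - limit_cdf c a"
      "limit_cdf c b - limit_cdf c a \<le> sqrt (c + 4) * (b - a)"
      using limit_cdf_diff[OF c, of a b 0 "sqrt (c + 4)"] ab limit_density_nonneg[OF c] by auto
  qed
  have "sqrt (c + 4) * (b - a) > 0" using c ab by simp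
  from eventually_const_le_mult[OF this, of "3 * pi"] eventually_coefficient_le eventually_gt_at_top[of 0]
  show ?thesis
  proof eventually_elim
    case (elim l)
    define L where "L = sqrt (real l)"
    have L: "L > 0" "L * L = real l" using elim by (auto simp: L_def)
    have H': "\<gamma> l > - 1" "1 \<le> l" "gen_hermite (\<gamma> l) l (H l)" using elim \<gamma> H by auto
    have L_less: "L * a < L * b" using ab L by simp
    have "pi * (zeros l b - zeros l a) \<le>
        4 * (L * b - L * a) * sqrt (2 * real l + \<gamma> l + 1) + 3 * pi"
      unfolding L_def[symmetric] by (rule zero_count_diff_crude[OF H' L_less])
    also have "4 * (L * b - L * a) * sqrt (2 * real l + \<gamma> l + 1) \<le> 4 * (L * b - L * a) * (L * sqrt (c + 4))"
    proof (rule mult_left_mono)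
      show "sqrt (2 * real l + \<gamma> l + 1) \<le> L * sqrt (c + 4)"
        using elim unfolding L_def by (simp flip: real_sqrt_mult)
    qed (use L_less in simp)
    also have "4 * (L * b - L * a) * (L * sqrt (c + 4)) = real l * (4 * sqrt (c + 4) * (b - a))"
      unfolding L(2)[symmetric] by (simp add: algebra_simps)
    finally have upper: "pi * (zeros l b - zeros l a) \<le> real l * (4 * sqrt (c + 4) * (b - a)) + 3 * pi"
      by simp
    have "zeros l b - zeros l a \<ge> 0"
      using gen_hermite_nonzero[OF H'] L_less by (simp add: zero_count_diff L_def[symmetric])
    then have lower: "pi * (zeros l b - zeros l a) \<ge> 0" by simp
    have "0 \<le> real l * (limit_cdf c b - limit_cdf c a)" using cdf by simp
    moreover have "real l * (limit_cdf c b - limit_cdf c a) \<le> real l * (sqrt (c + 4) * (b - a))"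
      using cdf by (auto intro!: mult_left_mono)
    moreover have "0 \<le> real l * (sqrt (c + 4) * (b - a))" using c ab by simp
    moreover have "real l * (5 * sqrt (c + 4) * (b - a)) = 5 * (real l * (sqrt (c + 4) * (b - a)))"
      "real l * (4 * sqrt (c + 4) * (b - a)) = 4 * (real l * (sqrt (c + 4) * (b - a)))" by simp_all
    ultimately show ?case using upper lower elim(1) by linarith
  qed
qed

text \<open>The second summand of the error function pays for the crude bound near the singularity at 0.\<close>
lemma zeros_global:
  fixes e \<delta> :: real
  assumes e: "e > 0" and \<delta>: "\<delta> > 0" and ab: "a \<le> b"
  defines "E \<equiv> \<lambda>s. 4 * e * s + 5 * sqrt (c + 4) * max (- \<delta>) (min \<delta> s)"
  shows "\<forall>\<^sub>F l in sequentially. \<bar>pi * (zeros l b - zeros l a) -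
      real l * (limit_cdf c b - limit_cdf c a)\<bar> \<le> real l * (E b - E a)"
  using ab
proof (induction rule: Bolzano)
  \<comment> \<open>Increments of \<open>E\<close> add up exactly, and joining two intervals
    intersects only two eventual statements.\<close>
  case (trans a b d)
  from trans(1,2) show ?case by eventually_elim (simp add: algebra_simps abs_le_iff)
next
  case (local x)
  have C: "5 * sqrt (c + 4) \<ge> 0" using c by simp
  show ?case
  proof (cases "x = 0")
    case False
    from zeros_local[OF False e] obtain d where d: "d > 0"
      "\<And>a b. a \<le> x \<and> x \<le> b \<and> b - a < d \<Longrightarrow> \<forall>\<^sub>F l in sequentially.
         \<bar>pi * (zeros l b - zeros l a) - real l * (limit_cdf c b - limit_cdf c a)\<bar>
           \<le> real l * (4 * e * (b - a))" by blast
    have "\<forall>\<^sub>F l in sequentially. \<bar>pi * (zeros l b - zeros l a) -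
      real l * (limit_cdf c b - limit_cdf c a)\<bar> \<le> real l * (E b - E a)"
      if "a \<le> x \<and> x \<le> b \<and> b - a < d" for a b
    proof -
      have "4 * e * (b - a) \<le> E b - E a"
      proof -
        have "5 * sqrt (c + 4) * max (- \<delta>) (min \<delta> a) \<le> 5 * sqrt (c + 4) * max (- \<delta>) (min \<delta> b)"
          using that C by (intro mult_left_mono) auto
        then show ?thesis by (simp add: E_def algebra_simps)
      qed
      from mult_left_mono[OF this] have "real l * (4 * e * (b - a)) \<le> real l * (E b - E a)" for l by simp
      with d(2)[OF that] show ?thesis by (auto elim!: eventually_mono intro: order_trans)
    qed
    then show ?thesis using d(1) by blast
  next
    \<comment> \<open>Intervals around 0 shorter than \<delta> lie where the clamp is the identity.
      In total the clamp rises by at most 2 \<delta>, however many intervals the bisection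
      uses.\<close>
    case True
    have "\<forall>\<^sub>F l in sequentially. \<bar>pi * (zeros l b - zeros l a) -
      real l * (limit_cdf c b - limit_cdf c a)\<bar> \<le> real l * (E b - E a)"
      if ab: "a \<le> x \<and> x \<le> b \<and> b - a < \<delta>" for a b
    proof (cases "a = b")
      case False
      then have "a < b" using ab by simp
      have "5 * sqrt (c + 4) * (b - a) \<le> E b - E a"
      proof -
        have "max (- \<delta>) (min \<delta> a) = a" "max (- \<delta>) (min \<delta> b) = b" using ab True by auto
        moreover have "0 \<le> 4 * e * (b - a)" using e \<open>a < b\<close> by simp
        ultimately show ?thesis by (simp add: E_def algebra_simps)
      qed
      from mult_left_mono[OF this]
      have "real l * (5 * sqrt (c + 4) * (b - a)) \<le> real l * (E b - E a)" for l by simp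
      with zeros_local_crude[OF \<open>a < b\<close>] show ?thesis
        by (auto elim!: eventually_mono intro: order_trans)
    qed simp
    then show ?thesis using \<delta> by blast
  qed
qed

lemma zeros_tendsto: "(\<lambda>l. 1 / real l * zeros l y) \<longlonglongrightarrow> 1 / pi * limit_cdf c y"
proof (rule tendstoI)
  fix \<epsilon> :: real assume \<epsilon>: "\<epsilon> > 0"
  \<comment> \<open>Left of \<open>A\<close> there is no limit mass and, for large \<open>l\<close>,
    at most one zero.\<close>
  define A where "A = min y (- (c + 4))"
  \<comment> \<open>\<open>e\<close> and \<open>\<delta>\<close> let each summand of
    \<open>E\<close> grow by at most \<epsilon> from \<open>A\<close> to \<open>y\<close>; the added
    1 covers y = A.\<close>
  define e where "e = \<epsilon> / (4 * (y - A + 1))"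
  define \<delta> where "\<delta> = \<epsilon> / (10 * sqrt (c + 4))"
  define E where "E = (\<lambda>s. 4 * e * s + 5 * sqrt (c + 4) * max (- \<delta>) (min \<delta> s))"
  have A: "A \<le> y" "A \<le> - (c + 4)" by (auto simp: A_def)
  have pos: "e > 0" "\<delta> > 0" using A \<epsilon> c by (auto simp: e_def \<delta>_def)
  have E: "E y - E A \<le> 2 * \<epsilon>"
  proof -
    have "4 * e * (y - A) \<le> \<epsilon>"
    proof -
      have "4 * e * (y - A) \<le> 4 * e * (y - A + 1)" using pos by simp
      also have "\<dots> = \<epsilon>" using A by (simp add: e_def field_simps)
      finally show ?thesis .
    qed
    moreover have "5 * sqrt (c + 4) * (max (- \<delta>) (min \<delta> y) - max (- \<delta>) (min \<delta> A)) \<le> \<epsilon>"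
    proof -
      have "5 * sqrt (c + 4) * (max (- \<delta>) (min \<delta> y) - max (- \<delta>) (min \<delta> A)) \<le>
          5 * sqrt (c + 4) * (2 * \<delta>)"
        using pos c by (intro mult_left_mono) auto
      also have "\<dots> = \<epsilon>" using c by (simp add: \<delta>_def field_simps)
      finally show ?thesis .
    qed
    ultimately show ?thesis by (simp add: E_def algebra_simps)
  qed
  have "\<forall>\<^sub>F l in sequentially. \<bar>pi * (zeros l y - zeros l A) -
      real l * (limit_cdf c y - limit_cdf c A)\<bar> \<le> real l * (E y - E A)"
    unfolding E_def by (rule zeros_global[OF pos A(1)])
  \<comment> \<open>The counts carry a factor pi, so an error of 2 \<epsilon> leaves room below pi
    \<epsilon>; half of that room absorbs the zero that may lie left of \<open>A\<close>.\<close>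
  moreover have "pi * \<epsilon> - 2 * \<epsilon> > 0" using \<epsilon> pi_gt3 by (simp flip: left_diff_distrib)
  from eventually_const_le_mult[OF half_gt_zero[OF this], of pi]
  have "\<forall>\<^sub>F l in sequentially. pi \<le> real l * ((pi * \<epsilon> - 2 * \<epsilon>) / 2)" .
  ultimately show "\<forall>\<^sub>F l in sequentially. dist (1 / real l * zeros l y) (1 / pi * limit_cdf c y) < \<epsilon>"
    using eventually_zeros_far[OF A(2)] eventually_gt_at_top[of 0]
  proof eventually_elim
    case (elim l)
    have l: "real l > 0" using elim by simp
    have "real l * (E y - E A) \<le> real l * (2 * \<epsilon>)" using E by (intro mult_left_mono) auto
    moreover have "pi * zeros l A \<le> pi * 1" using elim by (intro mult_left_mono) auto
    moreover have "0 \<le> pi * zeros l A" by simp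
    moreover have "real l * ((pi * \<epsilon> - 2 * \<epsilon>) / 2) < real l * (pi * \<epsilon> - 2 * \<epsilon>)"
      using l \<open>pi * \<epsilon> - 2 * \<epsilon> > 0\<close> by simp
    moreover have "real l * (pi * \<epsilon> - 2 * \<epsilon>) = real l * (pi * \<epsilon>) - real l * (2 * \<epsilon>)"
      by (rule right_diff_distrib)
    moreover have "\<bar>(pi * zeros l y - pi * zeros l A) - real l * limit_cdf c y\<bar> \<le> real l * (E y - E A)"
      using elim(1) by (simp only: limit_cdf_far[OF c A(2)] right_diff_distrib[of pi] diff_zero)
    ultimately have "\<bar>pi * zeros l y - real l * limit_cdf c y\<bar> < real l * (pi * \<epsilon>)"
      using elim(2) by linarith
    moreover have "1 / real l * zeros l y - 1 / pi * limit_cdf c y =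
        (pi * zeros l y - real l * limit_cdf c y) / (real l * pi)"
      using l by (simp add: field_simps)
    ultimately show ?case
      using l by (simp add: dist_real_def abs_mult pos_divide_less_eq mult_ac)
  qed
qed

end

theorem theorem4p5:
  fixes \<gamma> :: "nat \<Rightarrow> real" and c y :: real and H :: "nat \<Rightarrow> real poly"
  assumes "\<And>l. l \<ge> 1 \<Longrightarrow> \<gamma> l > -1"
    and "(\<lambda>l. \<gamma> l / real l) \<longlonglongrightarrow> c"
    and "c \<ge> 0"
    and "\<And>l. l \<ge> 1 \<Longrightarrow> gen_hermite (\<gamma> l) l (H l)"
  shows "(\<lambda>l. 1 / real l * real (zero_count (H l) (sqrt (real l) * y)))
    \<longlonglongrightarrow> 1 / pi * (LINT x:{..y}|lborel.
          sqrt ((c + 1) - \<bar>x\<^sup>2 - c / 2 - 1\<bar>\<^sup>2) / \<bar>x\<bar> * indicator (closure (E1 c)) x)"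
  using zeros_tendsto[OF assms, of y] unfolding limit_cdf_def limit_density_def .

end
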